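(* Let $R:=\mathbb{Z}_2[[x]]$ be the power series ring in one variable over the $2$-adic integers, let $a\geq2$ be an integer, and let $f:=2^a+x^2\in R$. Then $\operatorname{ppt}(R,f)=1/2$.
   Context: For an integral domain $S$, $S^+$ denotes its absolute integral closure, i.e. the integral closure of $S$ in a fixed algebraic closure of its fraction field. For $z\in S^+$ and a rational $\alpha=n/m\geq 0$ ($n,m\in\mathbb{Z}$, $m>0$), $z^\alpha$ denotes a choice of element of $S^+$ with $(z^\alpha)^m=z^n$; it is unique up to units, and nothing below depends on the choice. Plus-pure threshold: for a complete Noetherian local domain $(S,\mathfrak{m})$ of residue characteristic $p>0$ and $0\neq f\in\mathfrak{m}$, $$\operatorname{ppt}(S,f)=\sup\{\alpha\in\mathbb{Q}_{\geq0}\mid \text{the } S\text{-linear map } S\to S^+,\ 1\mapsto f^\alpha,\ \text{is pure}\}$$ (since $S$ is complete, pure is equivalent to split). *)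

theory Defs
  imports
    "HOL-Algebra.Free_Abelian_Groups"
    "HOL-Algebra.Algebraic_Closure_Type"
    "HOL-Algebra.Coset"
    "HOL-Computational_Algebra.Computational_Algebra"
    "HOL-Library.Extended_Real"
begin

section \<open>The ring of 2-adic integers\<close>

text \<open>
  The inverse limit of the rings of integers modulo \<open>2 ^ n\<close>: the \<open>n\<close>-th entry of a compatible
  sequence is the representative in \<open>{0..<2 ^ n}\<close>.
\<close>

typedef two_adic_int =
  "{x :: nat \<Rightarrow> int. \<forall>n. 0 \<le> x n \<and> x n < 2 ^ n \<and> x (Suc n) mod 2 ^ n = x n}"
  by (rule exI[of _ "\<lambda>_. 0"]) simp

setup_lifting type_definition_two_adic_int

lemma mod_mod_pow2: "(a mod 2 ^ Suc n) mod 2 ^ n = a mod (2 ^ n :: int)"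
  by (rule mod_mod_cancel) simp

instantiation two_adic_int :: comm_ring_1
begin

lift_definition zero_two_adic_int :: two_adic_int is "\<lambda>_. 0"
  by simp

lift_definition one_two_adic_int :: two_adic_int is "\<lambda>n. 1 mod 2 ^ n"
  by (simp only: mod_mod_pow2 pos_mod_sign pos_mod_bound zero_less_power zero_less_numeral simp_thms)

lift_definition plus_two_adic_int :: "two_adic_int \<Rightarrow> two_adic_int \<Rightarrow> two_adic_int"
  is "\<lambda>x y n. (x n + y n) mod 2 ^ n"
  by (simp only: mod_mod_pow2 pos_mod_sign pos_mod_bound zero_less_power zero_less_numeral simp_thms)
    (metis mod_add_eq)

lift_definition minus_two_adic_int :: "two_adic_int \<Rightarrow> two_adic_int \<Rightarrow> two_adic_int"
  is "\<lambda>x y n. (x n - y n) mod 2 ^ n"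
  by (simp only: mod_mod_pow2 pos_mod_sign pos_mod_bound zero_less_power zero_less_numeral simp_thms)
    (metis mod_diff_eq)

lift_definition uminus_two_adic_int :: "two_adic_int \<Rightarrow> two_adic_int"
  is "\<lambda>x n. (- x n) mod 2 ^ n"
  by (simp only: mod_mod_pow2 pos_mod_sign pos_mod_bound zero_less_power zero_less_numeral simp_thms)
    (metis mod_minus_eq)

lift_definition times_two_adic_int :: "two_adic_int \<Rightarrow> two_adic_int \<Rightarrow> two_adic_int"
  is "\<lambda>x y n. (x n * y n) mod 2 ^ n"
  by (simp only: mod_mod_pow2 pos_mod_sign pos_mod_bound zero_less_power zero_less_numeral simp_thms)
    (metis mod_mult_eq)

instance
proof
  fix a b c :: two_adic_int
  show "a * b * c = a * (b * c)"
    by transfer (simp add: mod_simps mult.assoc)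
  show "a * b = b * a"
    by transfer (simp add: mult.commute)
  show "1 * a = a"
    by transfer (simp only: mod_mult_left_eq mult_1 mod_pos_pos_trivial fun_eq_iff simp_thms)
  show "a + b + c = a + (b + c)"
    by transfer (simp add: mod_simps add.assoc)
  show "a + b = b + a"
    by transfer (simp add: add.commute)
  show "0 + a = a"
    by transfer (simp add: fun_eq_iff mod_pos_pos_trivial)
  show "- a + a = 0"
    by transfer (simp add: mod_simps)
  show "a - b = a + - b"
    by transfer (simp add: mod_simps)
  show "(a + b) * c = a * c + b * c"
    by transfer (simp add: mod_simps distrib_right)
  show "(0 :: two_adic_int) \<noteq> 1"
    by transfer (auto simp: fun_eq_iff intro!: exI[of _ "Suc 0"])
qed

end

lemma two_adic_int_compatible:
  assumes "\<forall>n. 0 \<le> x n \<and> x n < 2 ^ n \<and> x (Suc n) mod 2 ^ n = (x n :: int)" "m \<le> n"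
  shows "x n mod 2 ^ m = x m"
  using assms(2)
proof (induction n rule: dec_induct)
  case base
  show ?case using assms(1) by simp
next
  case (step n)
  have "x (Suc n) mod 2 ^ m = (x (Suc n) mod 2 ^ n) mod 2 ^ m"
    using step.hyps by (simp add: mod_mod_cancel le_imp_power_dvd)
  with step.IH show ?case using assms(1) by simp
qed

instance two_adic_int :: idom
proof
  fix a b :: two_adic_int
  assume "a \<noteq> 0" "b \<noteq> 0"
  then show "a * b \<noteq> 0"
  proof (transfer, goal_cases)
    case (1 x y)
    then obtain m k where mk: "x m \<noteq> 0" "y k \<noteq> 0"
      by (auto simp: fun_eq_iff)
    have "x (m + k) mod 2 ^ m \<noteq> 0" "y (m + k) mod 2 ^ k \<noteq> 0"
      using two_adic_int_compatible[of x m "m + k"] two_adic_int_compatible[of y k "m + k"] 1 mk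
      by simp_all
    then have nd: "\<not> 2 ^ m dvd x (m + k)" "\<not> 2 ^ k dvd y (m + k)"
      by (simp_all add: dvd_eq_mod_eq_0)
    have "\<not> 2 ^ (m + k) dvd x (m + k) * y (m + k)"
    proof
      assume d: "2 ^ (m + k) dvd x (m + k) * y (m + k)"
      have "2 ^ m dvd x (m + k) \<or> 2 ^ Suc k dvd y (m + k)"
        by (rule prime_elem_power_dvd_cases[OF d]) simp_all
      then show False
        using nd by (meson dvd_trans le_imp_power_dvd lessI less_imp_le)
    qed
    then have "(x (m + k) * y (m + k)) mod 2 ^ (m + k) \<noteq> 0"
      by (simp add: dvd_eq_mod_eq_0)
    then show ?case by (auto simp: fun_eq_iff)
  qed
qed


section \<open>Tensor products and purity\<close>

definition module_map :: "('r, 'k) ring_scheme \<Rightarrow> ('r, 'm, 'c) module_scheme \<Rightarrow>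
    ('r, 'n, 'd) module_scheme \<Rightarrow> ('m \<Rightarrow> 'n) \<Rightarrow> bool" where
  "module_map R M N h \<longleftrightarrow>
     h \<in> carrier M \<rightarrow> carrier N \<and>
     (\<forall>x\<in>carrier M. \<forall>y\<in>carrier M. h (x \<oplus>\<^bsub>M\<^esub> y) = h x \<oplus>\<^bsub>N\<^esub> h y) \<and>
     (\<forall>r\<in>carrier R. \<forall>x\<in>carrier M. h (r \<odot>\<^bsub>M\<^esub> x) = r \<odot>\<^bsub>N\<^esub> h x)"

definition tensor_relators :: "('r, 'k) ring_scheme \<Rightarrow> ('r, 'm, 'c) module_scheme \<Rightarrow>
    ('r, 'l, 'd) module_scheme \<Rightarrow> ('m \<times> 'l \<Rightarrow>\<^sub>0 int) set" where
  "tensor_relators R M L =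
     {frag_of (x \<oplus>\<^bsub>M\<^esub> x', y) - frag_of (x, y) - frag_of (x', y) |x x' y.
        x \<in> carrier M \<and> x' \<in> carrier M \<and> y \<in> carrier L} \<union>
     {frag_of (x, y \<oplus>\<^bsub>L\<^esub> y') - frag_of (x, y) - frag_of (x, y') |x y y'.
        x \<in> carrier M \<and> y \<in> carrier L \<and> y' \<in> carrier L} \<union>
     {frag_of (r \<odot>\<^bsub>M\<^esub> x, y) - frag_of (x, r \<odot>\<^bsub>L\<^esub> y) |r x y.
        r \<in> carrier R \<and> x \<in> carrier M \<and> y \<in> carrier L}"

definition tensor_relations :: "('r, 'k) ring_scheme \<Rightarrow> ('r, 'm, 'c) module_scheme \<Rightarrow>
    ('r, 'l, 'd) module_scheme \<Rightarrow> ('m \<times> 'l \<Rightarrow>\<^sub>0 int) set" where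
  "tensor_relations R M L =
     generate (free_Abelian_group (carrier M \<times> carrier L)) (tensor_relators R M L)"

text \<open>
  Only the additive group of the tensor product is needed, since injectivity of a linear map
  depends only on the underlying map of additive groups.
\<close>

definition tensor_product :: "('r, 'k) ring_scheme \<Rightarrow> ('r, 'm, 'c) module_scheme \<Rightarrow>
    ('r, 'l, 'd) module_scheme \<Rightarrow> ('m \<times> 'l \<Rightarrow>\<^sub>0 int) set monoid" where
  "tensor_product R M L =
     free_Abelian_group (carrier M \<times> carrier L) Mod tensor_relations R M L"

text \<open>
  The map \<open>h \<otimes> id\<close> from \<open>M \<otimes> L\<close> to \<open>N \<otimes> L\<close> induced by \<open>h\<close>; the lemma \<open>tensor_map_coset\<close> below
  shows that the result is the coset of the image of any representative.
\<close>

definition tensor_map :: "('r, 'k) ring_scheme \<Rightarrow> ('r, 'n, 'c) module_scheme \<Rightarrow>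
    ('r, 'l, 'd) module_scheme \<Rightarrow> ('m \<Rightarrow> 'n) \<Rightarrow>
    ('m \<times> 'l \<Rightarrow>\<^sub>0 int) set \<Rightarrow> ('n \<times> 'l \<Rightarrow>\<^sub>0 int) set" where
  "tensor_map R N L h C =
     {t + frag_extend (\<lambda>(x, y). frag_of (h x, y)) c |t c. t \<in> tensor_relations R N L \<and> c \<in> C}"

text \<open>
  The modules \<open>L\<close> range over those with carrier in the type of sets of sequences in the ring. Every
  finitely generated module has an isomorphic copy there, which is enough: the lemma
  \<open>pure_map_inj_on\<close> below derives injectivity for modules on an arbitrary type.
\<close>

definition pure_map :: "('r, 'k) ring_scheme \<Rightarrow> ('r, 'm, 'c) module_scheme \<Rightarrow>
    ('r, 'n, 'd) module_scheme \<Rightarrow> ('m \<Rightarrow> 'n) \<Rightarrow> bool" where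
  "pure_map R M N h \<longleftrightarrow> module_map R M N h \<and>
     (\<forall>L :: ('r, (nat \<Rightarrow> 'r) set) module. module R L \<longrightarrow>
        inj_on (tensor_map R N L h) (carrier (tensor_product R M L)))"


subsection \<open>Purity does not depend on the type of the test modules\<close>

lemma tensor_relators_closed:
  assumes "module R M" "module R L"
  shows "tensor_relators R M L \<subseteq> carrier (free_Abelian_group (carrier M \<times> carrier L))"
proof -
  interpret M: module R M by fact
  interpret L: module R L by fact
  have *: "frag_of p \<in> carrier (free_Abelian_group (carrier M \<times> carrier L)) \<longleftrightarrow>
      p \<in> carrier M \<times> carrier L" for p
    by simp
  have **: "u - v \<in> carrier (free_Abelian_group A)"
    if "u \<in> carrier (free_Abelian_group A)" "v \<in> carrier (free_Abelian_group A)" for u v A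
    using that keys_diff[of u v] by auto
  show ?thesis
    unfolding tensor_relators_def
    by (auto simp del: carrier_free_Abelian_group_iff intro!: ** simp: frag_of_in_free_Abelian_group)
qed

lemma tensor_relations_subgroup:
  assumes "module R M" "module R L"
  shows "subgroup (tensor_relations R M L) (free_Abelian_group (carrier M \<times> carrier L))"
  unfolding tensor_relations_def
  by (rule group.generate_is_subgroup[OF group_free_Abelian_group tensor_relators_closed[OF assms]])

lemma tensor_relations_closed:
  assumes "module R M" "module R L"
  shows "0 \<in> tensor_relations R M L"
    and "s \<in> tensor_relations R M L \<Longrightarrow> t \<in> tensor_relations R M L \<Longrightarrow> s + t \<in> tensor_relations R M L"
    and "s \<in> tensor_relations R M L \<Longrightarrow> - s \<in> tensor_relations R M L"
    and "s \<in> tensor_relations R M L \<Longrightarrow> t \<in> tensor_relations R M L \<Longrightarrow> s - t \<in> tensor_relations R M L"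
    and "s \<in> tensor_relators R M L \<Longrightarrow> s \<in> tensor_relations R M L"
    and "s \<in> tensor_relations R M L \<Longrightarrow> Poly_Mapping.keys s \<subseteq> carrier M \<times> carrier L"
proof -
  interpret T: subgroup "tensor_relations R M L" "free_Abelian_group (carrier M \<times> carrier L)"
    by (rule tensor_relations_subgroup[OF assms])
  show "0 \<in> tensor_relations R M L"
    using T.one_closed by simp
  show add: "s + t \<in> tensor_relations R M L"
    if "s \<in> tensor_relations R M L" "t \<in> tensor_relations R M L" for s t
    using T.m_closed[OF that] by simp
  show keys: "Poly_Mapping.keys s \<subseteq> carrier M \<times> carrier L" if "s \<in> tensor_relations R M L" for s
    using T.mem_carrier[OF that] by simp
  show uminus: "- s \<in> tensor_relations R M L" if "s \<in> tensor_relations R M L" for s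
    using T.m_inv_closed[OF that] keys[OF that] by simp
  show "s - t \<in> tensor_relations R M L"
    if "s \<in> tensor_relations R M L" "t \<in> tensor_relations R M L"
    using add[OF that(1) uminus[OF that(2)]] by simp
  show "s \<in> tensor_relations R M L" if "s \<in> tensor_relators R M L"
    using that unfolding tensor_relations_def by (rule generate.incl)
qed

lemma tensor_relations_induct [consumes 3, case_names zero relator uminus add]:
  assumes "module R M" "module R L" "t \<in> tensor_relations R M L"
    and "P 0" "\<And>s. s \<in> tensor_relators R M L \<Longrightarrow> P s"
    and "\<And>s. s \<in> tensor_relators R M L \<Longrightarrow> P s \<Longrightarrow> P (- s)"
    and "\<And>s t. s \<in> tensor_relations R M L \<Longrightarrow> t \<in> tensor_relations R M L \<Longrightarrow> P s \<Longrightarrow> P t \<Longrightarrow> P (s + t)"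
  shows "P t"
  using assms(3) unfolding tensor_relations_def
proof (induction rule: generate.induct)
  case one
  show ?case using assms(4) by simp
next
  case (incl s)
  then show ?case by (rule assms(5))
next
  case (inv s)
  then have "Poly_Mapping.keys s \<subseteq> carrier M \<times> carrier L"
    using subsetD[OF tensor_relators_closed[OF assms(1,2)]] by simp
  then show ?case using assms(5,6) inv by simp
next
  case (eng s t)
  then show ?case using assms(7) unfolding tensor_relations_def by simp
qed

lemma tensor_relations_map:
  assumes "module R M" "module R L" "module R N" "module R L'"
    and h: "module_map R M N h" and k: "module_map R L L' k"
    and t: "t \<in> tensor_relations R M L"
  shows "frag_extend (\<lambda>(x, y). frag_of (h x, k y)) t \<in> tensor_relations R N L'"
  using assms(1,2) t
proof (induction rule: tensor_relations_induct)
  case zero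
  show ?case using tensor_relations_closed(1)[OF assms(3,4)] by simp
next
  case (relator s)
  have "frag_extend (\<lambda>(x, y). frag_of (h x, k y)) s \<in> tensor_relators R N L'"
    using relator unfolding tensor_relators_def[of R M L]
  proof (elim UnE CollectE exE conjE, goal_cases)
    case (1 x x' y)
    with h k show ?thesis
      unfolding tensor_relators_def
      by (intro UnI1 CollectI exI[of _ "h x"] exI[of _ "h x'"] exI[of _ "k y"])
        (simp add: frag_extend_diff module_map_def Pi_iff)
  next
    case (2 x y y')
    with h k show ?thesis
      unfolding tensor_relators_def
      by (intro UnI1[OF UnI2] CollectI exI[of _ "h x"] exI[of _ "k y"] exI[of _ "k y'"])
        (simp add: frag_extend_diff module_map_def Pi_iff)
  next
    case (3 r x y)
    with h k show ?thesis
      unfolding tensor_relators_def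
      by (intro UnI2 CollectI exI[of _ r] exI[of _ "h x"] exI[of _ "k y"])
        (simp add: frag_extend_diff module_map_def Pi_iff)
  qed
  then show ?case by (rule tensor_relations_closed(5)[OF assms(3,4)])
next
  case (uminus s)
  then show ?case using tensor_relations_closed(3)[OF assms(3,4)] by (simp add: frag_extend_minus)
next
  case (add s t)
  then show ?case using tensor_relations_closed(2)[OF assms(3,4)] by (simp add: frag_extend_add)
qed

lemma module_map_id: "module_map R L L (\<lambda>y. y)"
  by (simp add: module_map_def)

lemma tensor_map_coset:
  assumes "module R M" "module R N" "module R L" and h: "module_map R M N h"
    and c: "c \<in> carrier (free_Abelian_group (carrier M \<times> carrier L))"
  shows "tensor_map R N L h
           (r_coset (free_Abelian_group (carrier M \<times> carrier L)) (tensor_relations R M L) c) =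
         r_coset (free_Abelian_group (carrier N \<times> carrier L)) (tensor_relations R N L)
           (frag_extend (\<lambda>(x, y). frag_of (h x, y)) c)" (is "?lhs = ?rhs")
proof
  let ?e = "frag_extend (\<lambda>(x, y). frag_of (h x, y))"
  show "?lhs \<subseteq> ?rhs"
  proof
    fix u assume "u \<in> ?lhs"
    then obtain t s where ts: "t \<in> tensor_relations R N L" "s \<in> tensor_relations R M L"
      and u: "u = t + ?e (s + c)"
      by (auto simp: tensor_map_def r_coset_def)
    have "?e s \<in> tensor_relations R N L"
      by (rule tensor_relations_map[OF assms(1,3,2,3) h module_map_id ts(2)])
    then have "t + ?e s \<in> tensor_relations R N L"
      by (rule tensor_relations_closed(2)[OF assms(2,3) ts(1)])
    then show "u \<in> ?rhs"
      by (auto simp: u r_coset_def frag_extend_add add.assoc intro!: bexI[of _ "t + ?e s"])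
  qed
  show "?rhs \<subseteq> ?lhs"
  proof
    fix u assume "u \<in> ?rhs"
    then obtain t where t: "t \<in> tensor_relations R N L" and u: "u = t + ?e (0 + c)"
      by (auto simp: r_coset_def)
    have "0 + c \<in> r_coset (free_Abelian_group (carrier M \<times> carrier L)) (tensor_relations R M L) c"
      using tensor_relations_closed(1)[OF assms(1,3)] by (force simp: r_coset_def)
    then show "u \<in> ?lhs"
      unfolding tensor_map_def using t u by blast
  qed
qed

lemma tensor_map_inj_on_iff:
  assumes "module R M" "module R N" "module R L" and h: "module_map R M N h"
  shows "inj_on (tensor_map R N L h) (carrier (tensor_product R M L)) \<longleftrightarrow>
    (\<forall>c. Poly_Mapping.keys c \<subseteq> carrier M \<times> carrier L \<longrightarrow>
       frag_extend (\<lambda>(x, y). frag_of (h x, y)) c \<in> tensor_relations R N L \<longrightarrow>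
       c \<in> tensor_relations R M L)" (is "?lhs \<longleftrightarrow> ?rhs")
proof -
  let ?e = "frag_extend (\<lambda>(x, y). frag_of (h x, y))"
  let ?F = "\<lambda>M. free_Abelian_group (carrier M \<times> carrier L)"
  have coset_eq: "r_coset (free_Abelian_group (carrier K \<times> carrier L)) (tensor_relations R K L) c =
      r_coset (free_Abelian_group (carrier K \<times> carrier L)) (tensor_relations R K L) d \<longleftrightarrow>
      c - d \<in> tensor_relations R K L" (is "?A c = ?A d \<longleftrightarrow> _") if K: "module R K" for c d and K :: "('a, 'x, 'y) module_scheme"
  proof
    assume "?A c = ?A d"
    moreover have "0 + c \<in> ?A c"
      using tensor_relations_closed(1)[OF K assms(3)] by (force simp: r_coset_def)
    ultimately obtain s where "s \<in> tensor_relations R K L" "c = s + d"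
      by (auto simp: r_coset_def)
    then show "c - d \<in> tensor_relations R K L" by simp
  next
    have sub: "?A c \<subseteq> ?A d" if "c - d \<in> tensor_relations R K L" for c d
    proof
      fix u assume "u \<in> ?A c"
      then obtain s where s: "s \<in> tensor_relations R K L" "u = s + c"
        by (auto simp: r_coset_def)
      have "s + (c - d) \<in> tensor_relations R K L"
        by (rule tensor_relations_closed(2)[OF K assms(3) s(1) that])
      then show "u \<in> ?A d"
        by (auto simp: r_coset_def s intro!: bexI[of _ "s + (c - d)"])
    qed
    assume cd: "c - d \<in> tensor_relations R K L"
    then have "d - c \<in> tensor_relations R K L"
      using tensor_relations_closed(3)[OF K assms(3) cd] by simp
    with cd sub show "?A c = ?A d" by blast
  qed
  have carr: "carrier (tensor_product R M L) =
      (\<lambda>c. r_coset (?F M) (tensor_relations R M L) c) ` {c. Poly_Mapping.keys c \<subseteq> carrier M \<times> carrier L}"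
    by (auto simp: tensor_product_def FactGroup_def RCOSETS_def)
  have map: "tensor_map R N L h (r_coset (?F M) (tensor_relations R M L) c) =
      r_coset (?F N) (tensor_relations R N L) (?e c)" if "Poly_Mapping.keys c \<subseteq> carrier M \<times> carrier L" for c
    using tensor_map_coset[OF assms(1,2,3) h] that by simp
  have "?lhs \<longleftrightarrow> (\<forall>c d. Poly_Mapping.keys c \<subseteq> carrier M \<times> carrier L \<longrightarrow> Poly_Mapping.keys d \<subseteq> carrier M \<times> carrier L \<longrightarrow>
      ?e c - ?e d \<in> tensor_relations R N L \<longrightarrow> c - d \<in> tensor_relations R M L)"
    unfolding inj_on_def carr
    by (auto simp: map coset_eq[OF assms(1)] coset_eq[OF assms(2)])
  also have "\<dots> \<longleftrightarrow> ?rhs"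
  proof
    assume *: "\<forall>c d. Poly_Mapping.keys c \<subseteq> carrier M \<times> carrier L \<longrightarrow> Poly_Mapping.keys d \<subseteq> carrier M \<times> carrier L \<longrightarrow>
      ?e c - ?e d \<in> tensor_relations R N L \<longrightarrow> c - d \<in> tensor_relations R M L"
    show ?rhs
      using *[rule_format, where d = 0] by simp
  next
    assume *: ?rhs
    show "\<forall>c d. Poly_Mapping.keys c \<subseteq> carrier M \<times> carrier L \<longrightarrow> Poly_Mapping.keys d \<subseteq> carrier M \<times> carrier L \<longrightarrow>
      ?e c - ?e d \<in> tensor_relations R N L \<longrightarrow> c - d \<in> tensor_relations R M L"
    proof (intro allI impI)
      fix c d
      assume "Poly_Mapping.keys c \<subseteq> carrier M \<times> carrier L" "Poly_Mapping.keys d \<subseteq> carrier M \<times> carrier L"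
        and "?e c - ?e d \<in> tensor_relations R N L"
      then show "c - d \<in> tensor_relations R M L"
        using *[rule_format, of "c - d"] keys_diff[of c d] by (auto simp: frag_extend_diff)
    qed
  qed
  finally show ?thesis .
qed

text \<open>
  The set \<open>F\<close> supports \<open>t\<close>: membership of \<open>t\<close> in the relations is witnessed by relators all of
  whose \<open>L\<close>-entries lie in the submodule generated by \<open>F\<close>.
\<close>

lemma tensor_relations_finite_support:
  assumes "module R M" "module R L" "t \<in> tensor_relations R M L"
  shows "\<exists>F. finite F \<and> F \<subseteq> carrier L \<and>
    (\<forall>B. F \<subseteq> B \<longrightarrow> B \<subseteq> carrier L \<longrightarrow> module R (L\<lparr>carrier := B\<rparr>) \<longrightarrow>
       t \<in> tensor_relations R M (L\<lparr>carrier := B\<rparr>))"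
  using assms
proof (induction rule: tensor_relations_induct)
  case zero
  show ?case
    using tensor_relations_closed(1)[OF assms(1)] by (intro exI[of _ "{}"]) auto
next
  case (relator s)
  then obtain F where F: "finite F" "F \<subseteq> carrier L"
    "\<And>B. F \<subseteq> B \<Longrightarrow> s \<in> tensor_relators R M (L\<lparr>carrier := B\<rparr>)"
    unfolding tensor_relators_def
  proof (elim UnE CollectE exE conjE, goal_cases)
    case (1 x x' y)
    show ?case by (rule 1(1)[of "{y}"]) (use 1 in auto)
  next
    case (2 x y y')
    show ?case by (rule 2(1)[of "{y, y'}"]) (use 2 in auto)
  next
    case (3 r x y)
    show ?case by (rule 3(1)[of "{y}"]) (use 3 in auto)
  qed
  then show ?case
    using tensor_relations_closed(5)[OF assms(1)] by (intro exI[of _ F]) auto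
next
  case (uminus s)
  then show ?case using tensor_relations_closed(3)[OF assms(1)] by meson
next
  case (add s t)
  then obtain F G where "finite F" "F \<subseteq> carrier L" "finite G" "G \<subseteq> carrier L"
    and F: "\<And>B. F \<subseteq> B \<Longrightarrow> B \<subseteq> carrier L \<Longrightarrow> module R (L\<lparr>carrier := B\<rparr>) \<Longrightarrow> s \<in> tensor_relations R M (L\<lparr>carrier := B\<rparr>)"
    and G: "\<And>B. G \<subseteq> B \<Longrightarrow> B \<subseteq> carrier L \<Longrightarrow> module R (L\<lparr>carrier := B\<rparr>) \<Longrightarrow> t \<in> tensor_relations R M (L\<lparr>carrier := B\<rparr>)"
    by metis
  then show ?case
    by (intro exI[of _ "F \<union> G"] conjI allI impI tensor_relations_closed(2)[OF assms(1)] F G) auto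
qed

primrec lin_comb :: "('r, 'l, 'd) module_scheme \<Rightarrow> 'l list \<Rightarrow> (nat \<Rightarrow> 'r) \<Rightarrow> 'l" where
  "lin_comb L [] v = \<zero>\<^bsub>L\<^esub>"
| "lin_comb L (y # ys) v = (v 0 \<odot>\<^bsub>L\<^esub> y) \<oplus>\<^bsub>L\<^esub> lin_comb L ys (\<lambda>i. v (Suc i))"

lemma lin_comb_laws:
  assumes "module R L" "set ys \<subseteq> carrier L" "v \<in> UNIV \<rightarrow> carrier R" "w \<in> UNIV \<rightarrow> carrier R"
    and "r \<in> carrier R"
  shows "lin_comb L ys v \<in> carrier L"
    and "lin_comb L ys (\<lambda>i. v i \<oplus>\<^bsub>R\<^esub> w i) = lin_comb L ys v \<oplus>\<^bsub>L\<^esub> lin_comb L ys w"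
    and "lin_comb L ys (\<lambda>i. r \<otimes>\<^bsub>R\<^esub> v i) = r \<odot>\<^bsub>L\<^esub> lin_comb L ys v"
    and "lin_comb L ys (\<lambda>_. \<zero>\<^bsub>R\<^esub>) = \<zero>\<^bsub>L\<^esub>"
proof -
  interpret L: module R L by fact
  have closed: "lin_comb L ys v \<in> carrier L" if "v \<in> UNIV \<rightarrow> carrier R" for v
    using assms(2) that by (induction ys arbitrary: v) (auto simp: Pi_iff)
  show "lin_comb L ys v \<in> carrier L" by (rule closed) fact
  show "lin_comb L ys (\<lambda>_. \<zero>\<^bsub>R\<^esub>) = \<zero>\<^bsub>L\<^esub>"
    using assms(2) by (induction ys) auto
  have "lin_comb L ys v \<in> carrier L \<and> lin_comb L ys w \<in> carrier L \<and>
      lin_comb L ys (\<lambda>i. v i \<oplus>\<^bsub>R\<^esub> w i) = lin_comb L ys v \<oplus>\<^bsub>L\<^esub> lin_comb L ys w \<and>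
      lin_comb L ys (\<lambda>i. r \<otimes>\<^bsub>R\<^esub> v i) = r \<odot>\<^bsub>L\<^esub> lin_comb L ys v"
    using assms(2-5)
  proof (induction ys arbitrary: v w)
    case Nil
    then show ?case by auto
  next
    case (Cons y ys)
    have "(\<lambda>i. v (Suc i)) \<in> UNIV \<rightarrow> carrier R" "(\<lambda>i. w (Suc i)) \<in> UNIV \<rightarrow> carrier R"
      and "v 0 \<in> carrier R" "w 0 \<in> carrier R" "y \<in> carrier L" "set ys \<subseteq> carrier L"
      using Cons.prems by auto
    with Cons.IH[of "\<lambda>i. v (Suc i)" "\<lambda>i. w (Suc i)"] Cons.prems show ?case
      by (auto simp: L.smult_l_distr L.smult_r_distr L.smult_assoc1 L.M.a_ac)
  qed
  then show "lin_comb L ys (\<lambda>i. v i \<oplus>\<^bsub>R\<^esub> w i) = lin_comb L ys v \<oplus>\<^bsub>L\<^esub> lin_comb L ys w"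
    "lin_comb L ys (\<lambda>i. r \<otimes>\<^bsub>R\<^esub> v i) = r \<odot>\<^bsub>L\<^esub> lin_comb L ys v"
    by auto
qed

lemma lin_comb_member:
  assumes "module R L" "set ys \<subseteq> carrier L" "y \<in> set ys"
  shows "\<exists>v \<in> UNIV \<rightarrow> carrier R. lin_comb L ys v = y"
proof -
  interpret L: module R L by fact
  have zero: "lin_comb L ys (\<lambda>_. \<zero>\<^bsub>R\<^esub>) = \<zero>\<^bsub>L\<^esub>" if "set ys \<subseteq> carrier L" for ys
    using that by (induction ys) auto
  show ?thesis
    using assms(2,3)
  proof (induction ys)
    case Nil
    then show ?case by simp
  next
    case (Cons z zs)
    show ?case
    proof (cases "y = z")
      case True
      then show ?thesis
        using Cons.prems zero[of zs]
        by (intro bexI[of _ "\<lambda>i. if i = 0 then \<one>\<^bsub>R\<^esub> else \<zero>\<^bsub>R\<^esub>"]) auto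
    next
      case False
      then obtain v where "v \<in> UNIV \<rightarrow> carrier R" "lin_comb L zs v = y"
        using Cons by auto
      then show ?thesis
        using Cons.prems
        by (intro bexI[of _ "\<lambda>i. case i of 0 \<Rightarrow> \<zero>\<^bsub>R\<^esub> | Suc j \<Rightarrow> v j"]) (auto simp: Pi_iff split: nat.split)
    qed
  qed
qed

lemma module_lin_combs:
  assumes "module R L" "set ys \<subseteq> carrier L"
  shows "module R (L\<lparr>carrier := lin_comb L ys ` (UNIV \<rightarrow> carrier R)\<rparr>)" 
proof -
  interpret L: module R L by fact
  define B where "B = lin_comb L ys ` (UNIV \<rightarrow> carrier R)"
  have sub: "B \<subseteq> carrier L"
    unfolding B_def using lin_comb_laws(1)[OF assms _ _ L.R.zero_closed] by blast
  have add: "x \<oplus>\<^bsub>L\<^esub> y \<in> B" if xy: "x \<in> B" "y \<in> B" for x y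
  proof -
    obtain v w where vw: "v \<in> UNIV \<rightarrow> carrier R" "w \<in> UNIV \<rightarrow> carrier R"
      "x = lin_comb L ys v" "y = lin_comb L ys w"
      using xy by (auto simp: B_def)
    show ?thesis
      using vw by (auto simp: B_def lin_comb_laws(2)[OF assms vw(1,2) L.R.zero_closed, symmetric]
          intro!: imageI)
  qed
  have smult: "r \<odot>\<^bsub>L\<^esub> x \<in> B" if r: "r \<in> carrier R" and x: "x \<in> B" for r x
  proof -
    obtain v where v: "v \<in> UNIV \<rightarrow> carrier R" "x = lin_comb L ys v"
      using x by (auto simp: B_def)
    show ?thesis
      using v r by (auto simp: B_def lin_comb_laws(3)[OF assms v(1,1) r, symmetric] intro!: imageI)
  qed
  have zero: "\<zero>\<^bsub>L\<^esub> \<in> B"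
    unfolding B_def by (rule image_eqI[of _ _ "\<lambda>_. \<zero>\<^bsub>R\<^esub>"])
      (simp_all add: lin_comb_laws(4)[OF assms _ _ L.R.zero_closed, of "\<lambda>_. \<zero>\<^bsub>R\<^esub>" "\<lambda>_. \<zero>\<^bsub>R\<^esub>"])
  have inv: "\<exists>y\<in>B. y \<oplus>\<^bsub>L\<^esub> x = \<zero>\<^bsub>L\<^esub>" if x: "x \<in> B" for x
  proof (rule bexI)
    have xL: "x \<in> carrier L" using x sub by blast
    then show "(\<ominus>\<^bsub>R\<^esub> \<one>\<^bsub>R\<^esub>) \<odot>\<^bsub>L\<^esub> x \<oplus>\<^bsub>L\<^esub> x = \<zero>\<^bsub>L\<^esub>"
      by (simp add: L.smult_l_minus L.M.l_neg)
    show "(\<ominus>\<^bsub>R\<^esub> \<one>\<^bsub>R\<^esub>) \<odot>\<^bsub>L\<^esub> x \<in> B"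
      by (rule smult[OF _ x]) simp
  qed
  have inL: "x \<in> carrier L" if "x \<in> B" for x
    using that sub by blast
  show ?thesis
    unfolding B_def[symmetric]
  proof (rule moduleI)
    show "cring R" by (rule L.R.is_cring)
    show "abelian_group (L\<lparr>carrier := B\<rparr>)"
    proof (rule abelian_groupI)
      fix x assume "x \<in> carrier (L\<lparr>carrier := B\<rparr>)"
      then show "\<exists>y\<in>carrier (L\<lparr>carrier := B\<rparr>).
          y \<oplus>\<^bsub>L\<lparr>carrier := B\<rparr>\<^esub> x = \<zero>\<^bsub>L\<lparr>carrier := B\<rparr>\<^esub>"
        using inv by simp
    qed (simp_all add: add zero inL L.M.a_ac)
  qed (simp_all add: smult inL L.smult_l_distr L.smult_r_distr L.smult_assoc1)
qed

definition transport_module :: "('r, 'l, 'd) module_scheme \<Rightarrow> ('l \<Rightarrow> 'b) \<Rightarrow> ('r, 'b) module" where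
  "transport_module L b =
     (let g = inv_into (carrier L) b in
      \<lparr>carrier = b ` carrier L, monoid.mult = (\<lambda>x y. b (g x \<otimes>\<^bsub>L\<^esub> g y)), one = b \<one>\<^bsub>L\<^esub>,
       zero = b \<zero>\<^bsub>L\<^esub>, add = (\<lambda>x y. b (g x \<oplus>\<^bsub>L\<^esub> g y)), module.smult = (\<lambda>r x. b (r \<odot>\<^bsub>L\<^esub> g x))\<rparr>)"

lemma transport_module:
  assumes "module R L" and inj: "inj_on b (carrier L)"
  shows "module R (transport_module L b)"
    and "module_map R L (transport_module L b) b"
    and "module_map R (transport_module L b) L (inv_into (carrier L) b)"
proof -
  interpret L: module R L by fact
  have g [simp]: "inv_into (carrier L) b (b x) = x" if "x \<in> carrier L" for x
    using inj that by simp
  show "module R (transport_module L b)"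
  proof (rule moduleI)
    show "cring R" by (rule L.R.is_cring)
    show "abelian_group (transport_module L b)"
    proof (rule abelian_groupI)
      fix x assume "x \<in> carrier (transport_module L b)"
      then obtain u where u: "u \<in> carrier L" "x = b u"
        by (auto simp: transport_module_def Let_def)
      then show "\<exists>y\<in>carrier (transport_module L b).
          y \<oplus>\<^bsub>transport_module L b\<^esub> x = \<zero>\<^bsub>transport_module L b\<^esub>"
        by (auto simp: transport_module_def Let_def L.M.l_neg intro!: bexI[of _ "\<ominus>\<^bsub>L\<^esub> u"])
    qed (auto simp: transport_module_def Let_def L.M.a_ac)
  qed (auto simp: transport_module_def Let_def L.smult_l_distr L.smult_r_distr L.smult_assoc1)
  show "module_map R L (transport_module L b) b"
    by (auto simp: module_map_def transport_module_def Let_def)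
  show "module_map R (transport_module L b) L (inv_into (carrier L) b)"
    by (auto simp: module_map_def transport_module_def Let_def)
qed

lemma frag_extend_comp:
  "frag_extend (\<lambda>(x, y). frag_of (p' x, q' y)) (frag_extend (\<lambda>(x, y). frag_of (p x, q y)) d) =
   frag_extend (\<lambda>(x, y). frag_of (p' (p x), q' (q y))) d"
  using frag_extend_compose[of "\<lambda>(x, y). frag_of (p' x, q' y)" "\<lambda>(x, y). (p x, q y)" d]
  by (simp add: o_def case_prod_unfold)

theorem pure_map_inj_on:
  fixes R :: "('r, 'k) ring_scheme" and L :: "('r, 'l, 'e) module_scheme"
  assumes pure: "pure_map R M N h" and M: "module R M" and N: "module R N" and L: "module R L"
  shows "inj_on (tensor_map R N L h) (carrier (tensor_product R M L))"
proof -
  interpret L: module R L by fact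
  have h: "module_map R M N h"
    using pure by (simp add: pure_map_def)
  have "c \<in> tensor_relations R M L"
    if keys: "Poly_Mapping.keys c \<subseteq> carrier M \<times> carrier L"
      and rel: "frag_extend (\<lambda>(x, y). frag_of (h x, y)) c \<in> tensor_relations R N L" for c
  proof -
    obtain F where F: "finite F" "F \<subseteq> carrier L"
      "\<And>B. F \<subseteq> B \<Longrightarrow> B \<subseteq> carrier L \<Longrightarrow> module R (L\<lparr>carrier := B\<rparr>) \<Longrightarrow>
         frag_extend (\<lambda>(x, y). frag_of (h x, y)) c \<in> tensor_relations R N (L\<lparr>carrier := B\<rparr>)"
      using tensor_relations_finite_support[OF N L rel] by blast
    obtain ys where ys: "set ys = F \<union> snd ` Poly_Mapping.keys c"
      using F(1) finite_list[of "F \<union> snd ` Poly_Mapping.keys c"] by auto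
    have ysL: "set ys \<subseteq> carrier L"
      using F(2) keys ys by auto
    define B where "B = lin_comb L ys ` (UNIV \<rightarrow> carrier R)"
    define K where "K = L\<lparr>carrier := B\<rparr>"
    have K: "module R K"
      unfolding K_def B_def by (rule module_lin_combs[OF L ysL])
    have BL: "B \<subseteq> carrier L"
      unfolding B_def using lin_comb_laws(1)[OF L ysL _ _ L.R.zero_closed] by blast
    have ysB: "set ys \<subseteq> B"
      unfolding B_def using lin_comb_member[OF L ysL] by blast
    have relK: "frag_extend (\<lambda>(x, y). frag_of (h x, y)) c \<in> tensor_relations R N K"
      unfolding K_def using F(3)[of B] ysB ys BL K K_def by auto
    define b where "b = (\<lambda>y. {v \<in> UNIV \<rightarrow> carrier R. lin_comb L ys v = y})"
    have inj: "inj_on b (carrier K)"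
      by (rule inj_onI) (auto simp: b_def K_def B_def set_eq_iff)
    define K' where "K' = transport_module K b"
    note K' = transport_module[OF K inj, folded K'_def]
    define c' where "c' = frag_extend (\<lambda>(x, y). frag_of (x, b y)) c"
    have keysK: "Poly_Mapping.keys c \<subseteq> carrier M \<times> carrier K"
      using keys ysB ys by (force simp: K_def)
    have "frag_extend (\<lambda>(x, y). frag_of (x, b y)) (frag_extend (\<lambda>(x, y). frag_of (h x, y)) c)
        \<in> tensor_relations R N K'"
      by (rule tensor_relations_map[OF N K N K'(1) module_map_id K'(2) relK])
    then have "frag_extend (\<lambda>(x, y). frag_of (h x, y)) c' \<in> tensor_relations R N K'"
      unfolding c'_def
      by (simp only: frag_extend_comp)
    moreover have "Poly_Mapping.keys c' \<subseteq> carrier M \<times> carrier K'"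
    proof -
      have "b y \<in> carrier K'" if "y \<in> carrier K" for y
        using K'(2) that by (auto simp: module_map_def)
      then have "(\<Union>p\<in>Poly_Mapping.keys c. Poly_Mapping.keys ((\<lambda>(x, y). frag_of (x, b y)) p)) \<subseteq>
          carrier M \<times> carrier K'"
        using keysK by auto
      then show ?thesis
        unfolding c'_def by (rule subset_trans[OF keys_frag_extend])
    qed
    moreover have "inj_on (tensor_map R N K' h) (carrier (tensor_product R M K'))"
      using pure K'(1) by (simp add: pure_map_def)
    ultimately have "c' \<in> tensor_relations R M K'"
      unfolding tensor_map_inj_on_iff[OF M N K'(1) h] by blast
    moreover have "module_map R K' L (inv_into (carrier K) b)"
      using K'(3) BL by (auto simp: module_map_def K_def)
    ultimately have "frag_extend (\<lambda>(x, y). frag_of (x, inv_into (carrier K) b y)) c'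
        \<in> tensor_relations R M L"
      by (intro tensor_relations_map[OF M K'(1) M L module_map_id])
    also have "frag_extend (\<lambda>(x, y). frag_of (x, inv_into (carrier K) b y)) c' =
        frag_extend (\<lambda>(x, y). frag_of (x, inv_into (carrier K) b (b y))) c"
      unfolding c'_def by (rule frag_extend_comp)
    also have "\<dots> = frag_extend frag_of c"
      using keysK inj by (intro frag_extend_eq) auto
    also have "\<dots> = c"
      by (rule frag_expansion[symmetric])
    finally show ?thesis .
  qed
  then show ?thesis
    unfolding tensor_map_inj_on_iff[OF M N L h] by blast
qed


section \<open>Absolute integral closure and the plus-pure threshold\<close>

definition to_closure :: "'a::idom \<Rightarrow> 'a fract alg_closure" where
  "to_closure s = to_ac (to_fract s)"

definition absolute_integral_closure :: "'a::idom fract alg_closure set" where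
  "absolute_integral_closure =
     {z. \<exists>p :: 'a poly. lead_coeff p = 1 \<and> poly (map_poly to_closure p) z = 0}"

definition self_module :: "('a::comm_ring_1, 'a) module" where
  "self_module =
     \<lparr>carrier = UNIV, monoid.mult = (*), one = 1, zero = 0, add = (+), module.smult = (*)\<rparr>"

definition plus_module :: "('a::idom, 'a fract alg_closure) module" where
  "plus_module =
     \<lparr>carrier = absolute_integral_closure, monoid.mult = (*), one = 1, zero = 0, add = (+),
      module.smult = (\<lambda>s z. to_closure s * z)\<rparr>"

text \<open>
  A choice of the power \<open>z\<close> to the \<open>\<alpha>\<close>; any two choices differ by a root of unity, also when they
  come from different fractions representing \<open>\<alpha>\<close>.
\<close>

definition rat_power :: "'a::idom fract alg_closure \<Rightarrow> rat \<Rightarrow> 'a fract alg_closure" where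
  "rat_power z \<alpha> =
     (SOME w. w \<in> absolute_integral_closure \<and>
        (\<exists>n m :: nat. m > 0 \<and> \<alpha> = of_nat n / of_nat m \<and> w ^ m = z ^ n))"

lemma rat_power_to_closure:
  fixes f :: "'a::idom"
  assumes "0 \<le> \<alpha>"
  shows "rat_power (to_closure f) \<alpha> \<in> absolute_integral_closure"
    and "\<exists>n m :: nat. m > 0 \<and> \<alpha> = of_nat n / of_nat m \<and>
      rat_power (to_closure f) \<alpha> ^ m = to_closure f ^ n"
proof -
  obtain i j where ij: "quotient_of \<alpha> = (i, j)"
    by (cases "quotient_of \<alpha>")
  then have j: "j > 0" and \<alpha>: "\<alpha> = of_int i / of_int j"
    using quotient_of_denom_pos[OF ij] quotient_of_div[OF ij] by auto
  then have i: "i \<ge> 0"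
    using assms by (simp add: zero_le_divide_iff)
  define n m where "n = nat i" and "m = nat j"
  have m: "m > 0" and nm: "\<alpha> = of_nat n / of_nat m"
    using i j \<alpha> by (auto simp: n_def m_def)
  obtain w where w: "w ^ m = to_closure f ^ n"
    using nth_root_exists[of m "to_closure f ^ n"] m by auto
  have pow: "to_closure f ^ n = to_closure (f ^ n)"
    by (induction n) (simp_all add: to_closure_def)
  define p where "p = monom 1 m - [:f ^ n:]"
  have deg: "degree p = m" "lead_coeff p = 1"
  proof -
    have "degree [:f ^ n:] < degree (monom (1 :: 'a) m)"
      using m by (simp add: degree_monom_eq)
    then have "degree p = degree (monom (1 :: 'a) m)"
      unfolding p_def diff_conv_add_uminus by (intro degree_add_eq_left) simp
    then show "degree p = m"
      by (simp add: degree_monom_eq)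
    then show "lead_coeff p = 1"
      using m by (simp add: p_def coeff_pCons split: nat.split)
  qed
  have "map_poly to_closure p = monom 1 m - [:to_closure (f ^ n):]"
    by (rule poly_eqI)
      (simp add: p_def coeff_map_poly to_closure_def coeff_pCons split: nat.split)
  then have "poly (map_poly to_closure p) w = 0"
    using w pow by (simp add: poly_monom)
  with deg have "w \<in> absolute_integral_closure"
    unfolding absolute_integral_closure_def by blast
  with w m nm have ex: "\<exists>w. w \<in> absolute_integral_closure \<and>
      (\<exists>n m :: nat. m > 0 \<and> \<alpha> = of_nat n / of_nat m \<and> w ^ m = to_closure f ^ n)"
    by blast
  show "rat_power (to_closure f) \<alpha> \<in> absolute_integral_closure"
    and "\<exists>n m :: nat. m > 0 \<and> \<alpha> = of_nat n / of_nat m \<and>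
      rat_power (to_closure f) \<alpha> ^ m = to_closure f ^ n"
    using someI_ex[OF ex] unfolding rat_power_def by blast+
qed

text \<open>
  To be used for a complete Noetherian local domain of residue characteristic \<open>p > 0\<close> and a nonzero
  \<open>f\<close> in its maximal ideal. The supremum is taken in the extended reals, where it always exists.
\<close>

definition ppt :: "'a::idom \<Rightarrow> ereal" where
  "ppt f =
     (SUP \<alpha> \<in> {\<alpha> :: rat. 0 \<le> \<alpha> \<and>
        pure_map ring_of_type_algebra self_module plus_module
          (\<lambda>s. to_closure s * rat_power (to_closure f) \<alpha>)}.
      ereal (real_of_rat \<alpha>))"

end

theory Submission
  imports Defs "HOL-Analysis.Function_Topology" "Jordan_Normal_Form.Char_Poly" "HOL-Library.Z2"
begin

text \<open>
  With \<open>y\<^sup>2 = f\<close> one has \<open>y = x + 2 v\<close>, where \<open>v\<^sup>2 + x v = 2\<^sup>a\<^sup>-\<^sup>2\<close>, so \<open>v\<close> is integral. If \<open>\<alpha> \<ge> 1/2\<close>, then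
  \<open>f\<^sup>\<alpha>\<close> is an integral multiple of \<open>y\<close> and hence lies in the extension of \<open>(2, x)\<close>; tensoring with the
  residue field shows that \<open>1 \<mapsto> f\<^sup>\<alpha>\<close> is not pure.

  Let \<open>\<alpha> = n/m < 1/2\<close> and \<open>w = f\<^sup>\<alpha>\<close>. If \<open>(2 x)\<^sup>k w\<close> were in \<open>(2\<^sup>k\<^sup>+\<^sup>1, x\<^sup>k\<^sup>+\<^sup>1)\<close>, then \<open>w\<close> would be
  in \<open>(2, x)\<close>, since \<open>2, x\<close> is a regular sequence. As \<open>f\<close> is congruent to \<open>x\<^sup>2\<close> modulo \<open>2\<close>, comparing
  \<open>w\<^sup>m = f\<^sup>n\<close> modulo \<open>2\<close> and cancelling \<open>x\<^sup>2\<^sup>n\<close> would put \<open>1\<close> into \<open>(2, x)\<close>. Hence \<open>1 \<mapsto> w\<close> splits modulo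
  \<open>(2\<^sup>k, x\<^sup>k)\<close> for every \<open>k\<close>, and compactness of the power series ring turns these approximate splittings
  into an exact one.
\<close>

section \<open>The absolute integral closure is a ring\<close>

lemma to_closure_simps [simp]:
  "to_closure 0 = 0" "to_closure 1 = 1" "to_closure (r + s) = to_closure r + to_closure s"
  "to_closure (r * s) = to_closure r * to_closure s" "to_closure (- r) = - to_closure r"
  "to_closure (r - s) = to_closure r - to_closure s" "to_closure (r ^ n) = to_closure r ^ n"
  "to_closure r = to_closure s \<longleftrightarrow> r = s" "to_closure r = 0 \<longleftrightarrow> r = 0"
proof -
  show power: "to_closure (r ^ n) = to_closure r ^ n"
    by (induction n) (simp_all add: to_closure_def)
qed (simp_all add: to_closure_def)

interpretation to_closure: comm_ring_hom to_closure
  by unfold_locales simp_all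

text \<open>The monic equation solved for its top power, the form in which powers are reduced later
  on. Exponent 0 makes no exception, since the equation would then read 1 = 0.\<close>

lemma absolute_integral_closure_iff:
  "z \<in> absolute_integral_closure \<longleftrightarrow>
     (\<exists>n a. z ^ n = (\<Sum>i<n. to_closure (a i) * z ^ i))" 
proof
  assume "z \<in> absolute_integral_closure"
  then obtain p :: "'a poly" where p: "lead_coeff p = 1" "poly (map_poly to_closure p) z = 0"
    by (auto simp: absolute_integral_closure_def)
  have "poly (map_poly to_closure p) z = (\<Sum>i\<le>degree p. to_closure (coeff p i) * z ^ i)"
    by (simp add: poly_altdef degree_map_poly coeff_map_poly)
  also have "\<dots> = (\<Sum>i<degree p. to_closure (coeff p i) * z ^ i) + z ^ degree p"
    using p by (simp add: lessThan_Suc_atMost [symmetric])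
  finally have "z ^ degree p = (\<Sum>i<degree p. to_closure (- coeff p i) * z ^ i)"
    using p by (simp add: sum_negf eq_neg_iff_add_eq_0 add.commute)
  then show "\<exists>n a. z ^ n = (\<Sum>i<n. to_closure (a i) * z ^ i)"
    by (intro exI [of _ "degree p"] exI [of _ "\<lambda>i. - coeff p i"])
next
  assume "\<exists>n a. z ^ n = (\<Sum>i<n. to_closure (a i) * z ^ i)"
  then obtain n and a :: "nat \<Rightarrow> 'a" where *: "z ^ n = (\<Sum>i<n. to_closure (a i) * z ^ i)"
    by blast
  define p where "p = monom 1 n - (\<Sum>i<n. monom (a i) i)"
  have coeff: "coeff p k = (if k = n then 1 else if k < n then - a k else 0)" for k
    by (simp add: p_def coeff_sum)
  then have deg: "degree p = n"
    by (intro antisym degree_le le_degree) auto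
  have deg': "degree (map_poly to_closure p) = n"
    using coeff [of n] by (subst degree_map_poly) (auto simp: deg)
  have "poly (map_poly to_closure p) z = (\<Sum>i\<le>n. to_closure (coeff p i) * z ^ i)"
    by (simp add: poly_altdef deg' coeff_map_poly)
  also have "\<dots> = (\<Sum>i<n. to_closure (coeff p i) * z ^ i) + z ^ n"
    by (simp add: lessThan_Suc_atMost [symmetric] coeff)
  also have "\<dots> = 0"
    by (simp add: coeff * sum.distrib [symmetric])
  finally show "z \<in> absolute_integral_closure"
    using coeff [of n] deg by (auto simp: absolute_integral_closure_def)
qed

text \<open>The determinant trick: \<open>z\<close> is an eigenvalue of the matrix \<open>a\<close>.\<close>

lemma integral_if_finite_action:
  fixes n i0 :: nat and a :: "nat \<Rightarrow> nat \<Rightarrow> 'a::idom" and v :: "nat \<Rightarrow> 'a fract alg_closure"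
  assumes "\<And>i. i < n \<Longrightarrow> z * v i = (\<Sum>j<n. to_closure (a i j) * v j)"
    and "i0 < n" "v i0 \<noteq> 0"
  shows "z \<in> absolute_integral_closure"
proof -
  define A where "A = mat n n (\<lambda>(i, j). a i j)"
  define u where "u = vec n v"
  have A: "A \<in> carrier_mat n n"
    by (simp add: A_def)
  have "u \<noteq> 0\<^sub>v n"
    using assms(2,3) by (auto simp: u_def vec_eq_iff)
  moreover have "map_mat to_closure A *\<^sub>v u = z \<cdot>\<^sub>v u"
    using assms(1) by (intro eq_vecI) (auto simp: A_def u_def scalar_prod_def atLeast0LessThan)
  ultimately have "eigenvector (map_mat to_closure A) u z"
    using A by (auto simp: eigenvector_def u_def)
  then have "poly (char_poly (map_mat to_closure A)) z = 0"
    using eigenvalue_root_char_poly [of "map_mat to_closure A" n z] A by (auto simp: eigenvalue_def)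
  then have "poly (map_poly to_closure (char_poly A)) z = 0"
    by (simp add: to_closure.char_poly_hom [OF A])
  then show ?thesis
    using degree_monic_char_poly [OF A] by (auto simp: absolute_integral_closure_def)
qed

text \<open>The span \<open>V\<close> of the monomials y^k z^l with k < m and l < n is stable under
  y and z, hence under y + z and y z, so the determinant trick applies to both.\<close>

lemma integral_closure_ring:
  assumes "y \<in> absolute_integral_closure" "z \<in> absolute_integral_closure"
  shows "y + z \<in> absolute_integral_closure" "y * z \<in> absolute_integral_closure"
proof -
  obtain m a where a: "y ^ m = (\<Sum>i<m. to_closure (a i) * y ^ i)"
    using assms(1) by (auto simp: absolute_integral_closure_iff)
  obtain n b where b: "z ^ n = (\<Sum>i<n. to_closure (b i) * z ^ i)"
    using assms(2) by (auto simp: absolute_integral_closure_iff)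
  have mn: "m > 0" "n > 0"
    using a b by (auto intro!: gr0I)
  \<comment> \<open>One index i < m * n codes the pair (i div n, i mod n). In particular
    \<open>v 0\<close> is 1, the nonzero entry that the determinant trick asks for.\<close>
  define v where "v = (\<lambda>i. y ^ (i div n) * z ^ (i mod n))"
  define V where "V = {u. \<exists>c. u = (\<Sum>i<m * n. to_closure (c i) * v i)}"
  have add: "u + u' \<in> V" if u: "u \<in> V" "u' \<in> V" for u u'
  proof -
    obtain c c' where "u = (\<Sum>i<m * n. to_closure (c i) * v i)"
      "u' = (\<Sum>i<m * n. to_closure (c' i) * v i)"
      using u by (auto simp: V_def)
    then show ?thesis
      by (auto simp: V_def distrib_right sum.distrib intro!: exI [of _ "\<lambda>i. c i + c' i"])
  qed
  have smult: "to_closure r * u \<in> V" if u: "u \<in> V" for u r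
  proof -
    obtain c where "u = (\<Sum>i<m * n. to_closure (c i) * v i)"
      using u by (auto simp: V_def)
    then show ?thesis
      by (auto simp: V_def sum_distrib_left mult_ac intro!: exI [of _ "\<lambda>i. r * c i"])
  qed
  have zero: "0 \<in> V"
    by (auto simp: V_def intro!: exI [of _ "\<lambda>_. 0"])
  have sum: "sum g A \<in> V" if "\<And>i. i \<in> A \<Longrightarrow> g i \<in> V" for g and A :: "nat set"
    using that by (induction A rule: infinite_finite_induct) (auto simp: zero add)
  have gen: "y ^ k * z ^ l \<in> V" if "k < m" "l < n" for k l
  proof -
    have "k * n + l < Suc k * n" "Suc k * n \<le> m * n"
      using that by (auto simp del: mult_Suc intro!: mult_le_mono1) simp
    then have "k * n + l < m * n" by linarith
    moreover have "y ^ k * z ^ l = v (k * n + l)"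
      using that by (simp add: v_def)
    ultimately show ?thesis
      by (auto simp: V_def intro!: exI [of _ "\<lambda>i. if i = k * n + l then 1 else 0"]
        simp: if_distrib [of to_closure] if_distrib [of "\<lambda>x. x * _"] cong: if_cong)
  qed
  have v_V: "v i \<in> V" if "i < m * n" for i
    unfolding v_def using that mn by (intro gen) (auto simp: less_mult_imp_div_less)
  \<comment> \<open>Only the top exponent leaves the range, and there the integral equation of
    \<open>y\<close> rewrites y^m in lower powers.\<close>
  have y_gen: "y * (y ^ k * z ^ l) \<in> V" if "k < m" "l < n" for k l
  proof (cases "Suc k = m")
    case True
    then have "y * (y ^ k * z ^ l) = y ^ m * z ^ l"
      by (auto simp: mult_ac)
    also have "\<dots> = (\<Sum>i<m. to_closure (a i) * (y ^ i * z ^ l))"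
      unfolding a by (simp add: sum_distrib_right mult.assoc)
    finally show ?thesis
      using that by (auto intro!: sum smult gen)
  next
    case False
    then show ?thesis using gen [of "Suc k" l] that by (simp add: mult_ac)
  qed
  have z_gen: "z * (y ^ k * z ^ l) \<in> V" if "k < m" "l < n" for k l
  proof (cases "Suc l = n")
    case True
    then have "z * (y ^ k * z ^ l) = y ^ k * z ^ n"
      by (auto simp: mult_ac)
    also have "\<dots> = (\<Sum>i<n. to_closure (b i) * (y ^ k * z ^ i))"
      unfolding b by (simp add: sum_distrib_left mult_ac)
    finally show ?thesis
      using that by (auto intro!: sum smult gen)
  next
    case False
    then show ?thesis using gen [of k "Suc l"] that by (simp add: mult_ac)
  qed
  have mult: "w * u \<in> V" if w: "\<And>i. i < m * n \<Longrightarrow> w * v i \<in> V" and "u \<in> V" for u w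
  proof -
    obtain c where "u = (\<Sum>i<m * n. to_closure (c i) * v i)"
      using \<open>u \<in> V\<close> by (auto simp: V_def)
    then have "w * u = (\<Sum>i<m * n. to_closure (c i) * (w * v i))"
      by (simp add: sum_distrib_left mult_ac)
    then show ?thesis
      by (auto intro!: sum smult w)
  qed
  have dm: "i div n < m" "i mod n < n" if "i < m * n" for i
    using that mn by (auto simp: less_mult_imp_div_less)
  have yV: "y * u \<in> V" if "u \<in> V" for u
    by (rule mult [OF _ that]) (simp add: v_def y_gen dm)
  have zV: "z * u \<in> V" if "u \<in> V" for u
    by (rule mult [OF _ that]) (simp add: v_def z_gen dm)
  have integral: "w \<in> absolute_integral_closure" if w: "\<And>u. u \<in> V \<Longrightarrow> w * u \<in> V" for w
  proof -
    have "\<forall>i. \<exists>c. i < m * n \<longrightarrow> w * v i = (\<Sum>j<m * n. to_closure (c j) * v j)"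
      using w v_V by (force simp: V_def)
    then obtain c where "\<And>i. i < m * n \<Longrightarrow> w * v i = (\<Sum>j<m * n. to_closure (c i j) * v j)"
      by metis
    moreover have "0 < m * n" "v 0 \<noteq> 0"
      using mn by (simp_all add: v_def)
    ultimately show ?thesis
      by (rule integral_if_finite_action)
  qed
  show "y + z \<in> absolute_integral_closure"
    by (rule integral) (auto simp: distrib_right intro: add yV zV)
  show "y * z \<in> absolute_integral_closure"
    by (rule integral) (auto simp: mult.assoc intro: yV zV)
qed

lemma to_closure_integral: "to_closure r \<in> absolute_integral_closure"
  unfolding absolute_integral_closure_iff
  by (intro exI [of _ 1] exI [of _ "\<lambda>_. r"]) simp

lemma uminus_integral:
  "z \<in> absolute_integral_closure \<Longrightarrow> - z \<in> absolute_integral_closure"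
  using integral_closure_ring(2) [OF to_closure_integral [of "- 1"], of z] by simp

lemma root_integral:
  assumes "n > 0" "z ^ n \<in> range to_closure"
  shows "z \<in> absolute_integral_closure"
proof -
  obtain r where "z ^ n = to_closure r" using assms(2) by blast
  then show ?thesis
    using assms(1) unfolding absolute_integral_closure_iff
    by (intro exI [of _ n] exI [of _ "\<lambda>i. if i = 0 then r else 0"])
      (simp add: if_distrib [of to_closure] if_distrib [of "\<lambda>x. x * _"] cong: if_cong)
qed

section \<open>Criteria for purity\<close>

lemma module_self_module:
  "module ring_of_type_algebra (self_module :: ('a::comm_ring_1, 'a) module)"
proof (rule moduleI)
  show "abelian_group (self_module :: ('a, 'a) module)"
  proof (rule abelian_groupI)
    fix x :: 'a
    show "\<exists>y\<in>carrier (self_module :: ('a, 'a) module). y \<oplus>\<^bsub>self_module\<^esub> x = \<zero>\<^bsub>self_module\<^esub>"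
      by (rule bexI [of _ "- x"]) (simp_all add: self_module_def)
  qed (simp_all add: self_module_def add_ac)
qed (simp_all add: self_module_def ring_of_type_algebra_def algebra_simps
    cring_from_type_algebra [unfolded ring_of_type_algebra_def])

lemma module_plus_module:
  "module ring_of_type_algebra (plus_module :: ('a::idom, 'a fract alg_closure) module)"
proof (rule moduleI)
  show "abelian_group (plus_module :: ('a, 'a fract alg_closure) module)"
  proof (rule abelian_groupI)
    fix x :: "'a fract alg_closure"
    assume "x \<in> carrier (plus_module :: ('a, 'a fract alg_closure) module)"
    then show "\<exists>y\<in>carrier (plus_module :: ('a, 'a fract alg_closure) module).
        y \<oplus>\<^bsub>plus_module\<^esub> x = \<zero>\<^bsub>plus_module\<^esub>"
      by (intro bexI [of _ "- x"]) (simp_all add: plus_module_def uminus_integral)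
  qed (use to_closure_integral [of 0] in
      \<open>simp_all add: plus_module_def add_ac integral_closure_ring\<close>)
qed (simp_all add: plus_module_def ring_of_type_algebra_def algebra_simps
    integral_closure_ring to_closure_integral
    cring_from_type_algebra [unfolded ring_of_type_algebra_def])

lemma module_map_plus_module:
  assumes "u \<in> absolute_integral_closure"
  shows "module_map ring_of_type_algebra self_module plus_module (\<lambda>s. to_closure s * u)"
  using assms
  by (simp add: module_map_def self_module_def plus_module_def ring_of_type_algebra_def
      integral_closure_ring to_closure_integral algebra_simps)

text \<open>The map induced by the retraction \<open>g\<close> respects the relations and sends the
  image of \<open>c\<close> back to \<open>c\<close>.\<close>

lemma pure_map_if_split:
  assumes M: "module R M" and N: "module R N"
    and h: "module_map R M N h" and g: "module_map R N M g"
    and split: "\<And>x. x \<in> carrier M \<Longrightarrow> g (h x) = x"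
  shows "pure_map R M N h"
  unfolding pure_map_def
proof (intro conjI allI impI)
  show "module_map R M N h" by (rule h)
  fix L :: "('a, (nat \<Rightarrow> 'a) set) module"
  assume L: "module R L"
  show "inj_on (tensor_map R N L h) (carrier (tensor_product R M L))"
    unfolding tensor_map_inj_on_iff [OF M N L h]
  proof (intro allI impI)
    fix c assume keys: "Poly_Mapping.keys c \<subseteq> carrier M \<times> carrier L"
      and "frag_extend (\<lambda>(x, y). frag_of (h x, y)) c \<in> tensor_relations R N L"
    then have "frag_extend (\<lambda>(x, y). frag_of (g x, y))
        (frag_extend (\<lambda>(x, y). frag_of (h x, y)) c) \<in> tensor_relations R M L"
      by (intro tensor_relations_map [OF N L M L g module_map_id])
    also have "frag_extend (\<lambda>(x, y). frag_of (g x, y))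
        (frag_extend (\<lambda>(x, y). frag_of (h x, y)) c) =
        frag_extend (\<lambda>(x, y). frag_of (g (h x), y)) c"
      by (rule frag_extend_comp)
    also have "\<dots> = frag_extend frag_of c"
      using keys by (intro frag_extend_eq) (auto simp: split)
    also have "\<dots> = c"
      by (rule frag_expansion [symmetric])
    finally show "c \<in> tensor_relations R M L" .
  qed
qed

text \<open>The target of \<open>e\<close> as a module over its source. Its elements have type
  \<open>'k\<close>, so in general purity reaches it only through
  \<open>pure_map_inj_on\<close>.\<close>

definition residue_module :: "('a \<Rightarrow> 'k) \<Rightarrow> ('a::comm_ring_1, 'k::comm_ring_1) module" where
  "residue_module e =
     \<lparr>carrier = UNIV, monoid.mult = (*), one = 1, zero = 0, add = (+),
      module.smult = (\<lambda>r y. e r * y)\<rparr>"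

lemma module_residue_module:
  fixes e :: "'a::comm_ring_1 \<Rightarrow> 'k::comm_ring_1"
  assumes "comm_ring_hom e"
  shows "module ring_of_type_algebra (residue_module e)"
proof -
  interpret comm_ring_hom e by fact
  show ?thesis
  proof (rule moduleI)
    show "abelian_group (residue_module e)"
    proof (rule abelian_groupI)
      fix x :: 'k
      show "\<exists>y\<in>carrier (residue_module e). y \<oplus>\<^bsub>residue_module e\<^esub> x = \<zero>\<^bsub>residue_module e\<^esub>"
        by (rule bexI [of _ "- x"]) (simp_all add: residue_module_def)
    qed (simp_all add: residue_module_def add_ac)
  qed (simp_all add: residue_module_def ring_of_type_algebra_def algebra_simps hom_add hom_mult
      cring_from_type_algebra [unfolded ring_of_type_algebra_def])
qed

text \<open>The assignment r \<otimes> y |-> e r * y is well defined on the tensor product: its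
  additive extension \<open>S\<close> kills every relator.\<close>

lemma tensor_relations_residue_sum:
  fixes e :: "'a::comm_ring_1 \<Rightarrow> 'k::comm_ring_1"
  assumes "comm_ring_hom e" "t \<in> tensor_relations ring_of_type_algebra self_module (residue_module e)"
  shows "(\<Sum>(r, y)\<in>Poly_Mapping.keys t. of_int (Poly_Mapping.lookup t (r, y)) * (e r * y)) = 0"
proof -
  interpret comm_ring_hom e by fact
  define S where "S = (\<lambda>t :: 'a \<times> 'k \<Rightarrow>\<^sub>0 int.
    \<Sum>p\<in>Poly_Mapping.keys t. of_int (Poly_Mapping.lookup t p) * (e (fst p) * snd p))"
  \<comment> \<open>Summing over any finite superset of the keys lets two arguments be compared over
    one index set, although keys may cancel in a difference.\<close>
  have S_eq: "S t = (\<Sum>p\<in>A. of_int (Poly_Mapping.lookup t p) * (e (fst p) * snd p))"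
    if "finite A" "Poly_Mapping.keys t \<subseteq> A" for t A
    unfolding S_def using that
    by (intro sum.mono_neutral_left) (auto simp: in_keys_iff)
  have S_diff: "S (s - t) = S s - S t" for s t
    using S_eq [of "Poly_Mapping.keys s \<union> Poly_Mapping.keys t"] keys_diff [of s t]
    by (simp add: lookup_minus sum_subtractf left_diff_distrib)
  have S_zero: "S 0 = 0"
    by (simp add: S_def)
  have S_uminus: "S (- t) = - S t" for t
    using S_diff [of 0 t] by (simp add: S_zero)
  have S_add: "S (s + t) = S s + S t" for s t
    using S_diff [of s "- t"] by (simp add: S_uminus)
  have S_of: "S (frag_of p) = e (fst p) * snd p" for p
    by (simp add: S_def)
  have "S t = 0"
    using module_self_module module_residue_module [OF assms(1)] assms(2)
  proof (induction rule: tensor_relations_induct)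
    case (relator s)
    then show ?case
      unfolding tensor_relators_def
      by (auto simp: S_diff S_of self_module_def residue_module_def hom_add hom_mult
          distrib_left distrib_right mult_ac)
  qed (simp_all add: S_zero S_uminus S_add)
  then show ?thesis
    by (simp add: S_def case_prod_unfold)
qed

text \<open>After tensoring with the target of \<open>e\<close>, the element 1 \<otimes> 1 goes to u
  \<otimes> 1 = b \<otimes> e p + c \<otimes> e q = 0, while the map r \<otimes> y |-> e r * y shows
  that 1 \<otimes> 1 is not zero.\<close>

lemma not_pure_if_in_ideal:
  fixes e :: "'a::idom \<Rightarrow> 'k::comm_ring_1"
  assumes e: "comm_ring_hom e" "e p = 0" "e q = 0"
    and bc: "b \<in> absolute_integral_closure" "c \<in> absolute_integral_closure"
    and u: "u = to_closure p * b + to_closure q * c"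
  shows "\<not> pure_map ring_of_type_algebra self_module plus_module (\<lambda>s. to_closure s * u)"
proof
  interpret comm_ring_hom e by fact
  let ?L = "residue_module e"
  let ?T = "tensor_relations ring_of_type_algebra plus_module ?L"
  note L = module_residue_module [OF e(1)]
  have u': "u \<in> absolute_integral_closure"
    unfolding u using bc by (intro integral_closure_ring to_closure_integral)
  assume "pure_map ring_of_type_algebra self_module plus_module (\<lambda>s. to_closure s * u)"
  note inj = pure_map_inj_on [OF this module_self_module module_plus_module L]
  note T = tensor_relations_closed [OF module_plus_module L]
  \<comment> \<open>The relator of 0 + 0 = 0 collapses to the negative of
    \<open>frag_of (z, 0)\<close>.\<close>
  have zero: "frag_of (z, 0) \<in> ?T" if "z \<in> absolute_integral_closure" for z
  proof -
    have "frag_of (z, 0 + 0) - frag_of (z, 0) - frag_of (z, 0) \<in> ?T"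
      by (rule T(5), unfold tensor_relators_def, rule UnI1, rule UnI2,
          intro CollectI exI [of _ z] exI [of _ 0])
        (use that in \<open>simp add: plus_module_def residue_module_def\<close>)
    from T(3) [OF this] show ?thesis by simp
  qed
  have smult: "frag_of (to_closure r * z, 1) \<in> ?T"
    if "z \<in> absolute_integral_closure" "e r = 0" for r z
  proof -
    have "frag_of (to_closure r * z, 1) - frag_of (z, e r * 1) \<in> ?T"
      by (rule T(5), unfold tensor_relators_def, rule UnI2,
          intro CollectI exI [of _ r] exI [of _ z] exI [of _ 1])
        (use that in \<open>simp add: plus_module_def residue_module_def ring_of_type_algebra_def\<close>)
    from T(2) [OF this zero [OF that(1)]] show ?thesis by (simp add: that)
  qed
  have "frag_of (to_closure p * b + to_closure q * c, 1) - frag_of (to_closure p * b, 1) -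
      frag_of (to_closure q * c, 1) \<in> ?T"
    by (rule T(5), unfold tensor_relators_def, rule UnI1, rule UnI1,
        rule CollectI, rule exI [of _ "to_closure p * b"], rule exI [of _ "to_closure q * c"],
        rule exI [of _ 1])
      (simp add: plus_module_def residue_module_def bc integral_closure_ring to_closure_integral)
  from T(2) [OF T(2) [OF this smult [OF bc(2) e(3)]] smult [OF bc(1) e(2)]]
  have "frag_of (u, 1) \<in> ?T"
    by (simp add: u)
  then have "frag_extend (\<lambda>(x, y). frag_of (to_closure x * u, y)) (frag_of (1, 1)) \<in> ?T"
    by simp
  with inj have "frag_of (1, 1) \<in> tensor_relations ring_of_type_algebra self_module ?L"
    unfolding tensor_map_inj_on_iff
      [OF module_self_module module_plus_module L module_map_plus_module [OF u']]
    by (auto simp: self_module_def residue_module_def)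
  from tensor_relations_residue_sum [OF e(1) this] show False
    by simp
qed

section \<open>Powers of a two-generated ideal\<close>

text \<open>Modulo \<open>p\<close> the factors \<open>x\<close> cancel one by one; dividing by
  \<open>p\<close> and repeating reaches p^m.\<close>

lemma regular_power:
  fixes p x :: "'a::idom" and m n :: nat
  assumes reg: "\<forall>r. p dvd x * r \<longrightarrow> p dvd r" and "p \<noteq> 0" and "p ^ m dvd x ^ n * r"
  shows "p ^ m dvd r"
proof -
  have reg': "p dvd r" if "p dvd x ^ n * r" for n r
    using that
  proof (induction n)
    case (Suc n)
    then have "p dvd x * (x ^ n * r)"
      by (simp only: power_Suc mult.assoc)
    with reg Suc.IH show ?case by blast
  qed simp
  show ?thesis
    using assms(3)
  proof (induction m arbitrary: r)
    case (Suc m)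
    then have "p dvd x ^ n * r"
      by (metis dvd_mult_left power_Suc)
    then obtain r' where r': "r = p * r'"
      using reg' by blast
    with Suc.prems \<open>p \<noteq> 0\<close> have "p ^ m dvd x ^ n * r'"
      by (simp add: mult.left_commute)
    then have "p ^ m dvd r'" by (rule Suc.IH)
    then show ?case by (simp add: r')
  qed simp
qed

text \<open>The ideal (p^n, x^n) rather than the n-th power of (p, x): for a regular sequence
  generating the maximal ideal and n > 0, the socle of its quotient is generated by the single
  element (p x)^(n-1).\<close>

definition power_ideal :: "'a::comm_ring_1 \<Rightarrow> 'a \<Rightarrow> nat \<Rightarrow> 'a set" where
  "power_ideal p x n = {p ^ n * r + x ^ n * s |r s. True}"

lemma power_ideal_closed:
  "0 \<in> power_ideal p x n"
  "r \<in> power_ideal p x n \<Longrightarrow> s \<in> power_ideal p x n \<Longrightarrow> r + s \<in> power_ideal p x n"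
  "r \<in> power_ideal p x n \<Longrightarrow> s * r \<in> power_ideal p x n"
  "p ^ n * r \<in> power_ideal p x n" "x ^ n * r \<in> power_ideal p x n"
proof -
  show "r + s \<in> power_ideal p x n" if rs: "r \<in> power_ideal p x n" "s \<in> power_ideal p x n"
  proof -
    obtain r1 s1 r2 s2 where "r = p ^ n * r1 + x ^ n * s1" "s = p ^ n * r2 + x ^ n * s2"
      using rs by (auto simp: power_ideal_def)
    then have "r + s = p ^ n * (r1 + r2) + x ^ n * (s1 + s2)"
      by (simp add: algebra_simps)
    then show ?thesis unfolding power_ideal_def by blast
  qed
  show "s * r \<in> power_ideal p x n" if r: "r \<in> power_ideal p x n"
  proof -
    obtain r1 s1 where "r = p ^ n * r1 + x ^ n * s1"
      using r by (auto simp: power_ideal_def)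
    then have "s * r = p ^ n * (s * r1) + x ^ n * (s * s1)"
      by (simp add: algebra_simps)
    then show ?thesis unfolding power_ideal_def by blast
  qed
  show "p ^ n * r \<in> power_ideal p x n"
    unfolding power_ideal_def by (intro CollectI exI [of _ r] exI [of _ 0]) simp
  show "x ^ n * r \<in> power_ideal p x n"
    unfolding power_ideal_def by (rule CollectI, rule exI [of _ 0], rule exI [of _ r]) simp
  show "0 \<in> power_ideal p x n"
    unfolding power_ideal_def by (intro CollectI exI [of _ 0]) simp
qed

lemma power_ideal_diff:
  "r \<in> power_ideal p x n \<Longrightarrow> s \<in> power_ideal p x n \<Longrightarrow> r - s \<in> power_ideal p x n"
  using power_ideal_closed(2) [of r p x n "- 1 * s"] power_ideal_closed(3) [of s p x n "- 1"]
  by simp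

text \<open>Take for \<open>i\<close> the predecessor of the first exponent at which the multiples
  of \<open>z\<close> enter \<open>S\<close>.\<close>

lemma last_multiple_outside:
  fixes q z :: "'a::monoid_mult"
  assumes "z \<notin> S" "q ^ k * z \<in> S"
  shows "\<exists>i. q ^ i * z \<notin> S \<and> q * (q ^ i * z) \<in> S"
  using assms by (induction k) (auto simp: mult.assoc)

text \<open>Multiply \<open>r\<close> by \<open>p\<close> and by \<open>x\<close> as long as the
  result stays outside the ideal. Regularity then identifies it as d' p^n x^n, and
  \<open>local\<close>, which leaves only the residue classes 0 and 1, allows replacing d' by
  1.\<close>

lemma power_ideal_socle:
  fixes p x :: "'a::idom" and n :: nat
  assumes reg: "\<forall>r. p dvd x * r \<longrightarrow> p dvd r" and "p \<noteq> 0" "x \<noteq> 0"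
    and local: "\<And>r. r \<in> power_ideal p x 1 \<or> r - 1 \<in> power_ideal p x 1"
    and r: "r \<notin> power_ideal p x (Suc n)"
  shows "\<exists>s. s * r - p ^ n * x ^ n \<in> power_ideal p x (Suc n)"
proof -
  let ?J = "power_ideal p x (Suc n)"
  note J = power_ideal_closed [where p = p and x = x and n = "Suc n"]
  obtain i where i: "p ^ i * r \<notin> ?J" "p * (p ^ i * r) \<in> ?J"
    using last_multiple_outside [OF r J(4)] by blast
  obtain j where j: "x ^ j * (p ^ i * r) \<notin> ?J" "x * (x ^ j * (p ^ i * r)) \<in> ?J"
    using last_multiple_outside [OF i(1) J(5)] by blast
  \<comment> \<open>Both \<open>p\<close> and \<open>x\<close> carry \<open>u\<close> into the
    ideal, so \<open>u\<close> represents a socle element.\<close>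
  define u where "u = x ^ j * (p ^ i * r)"
  have u: "u \<notin> ?J" "x * u \<in> ?J" "p * u \<in> ?J"
    using j J(3) [OF i(2), of "x ^ j"] by (simp_all add: u_def mult_ac)
  obtain a b where ab: "p * u = p ^ Suc n * a + x ^ Suc n * b"
    using u(3) by (auto simp: power_ideal_def)
  then have "x ^ Suc n * b = p * (u - p ^ n * a)"
    by (simp add: algebra_simps)
  \<comment> \<open>Regularity makes \<open>p\<close> divide the coefficient of x^(n+1), so the
    relation for p u can be divided by \<open>p\<close>.\<close>
  then have "p ^ 1 dvd x ^ Suc n * b"
    by (metis dvd_triv_left power_one_right)
  then have "p ^ 1 dvd b"
    by (rule regular_power [OF reg \<open>p \<noteq> 0\<close>])
  then obtain b' where "b = p * b'" by auto
  with ab have "p * u = p * (p ^ n * a + x ^ Suc n * b')"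
    by (simp add: algebra_simps)
  then have ub: "u = p ^ n * a + x ^ Suc n * b'"
    using \<open>p \<noteq> 0\<close> mult_left_cancel by blast
  \<comment> \<open>Membership of x u puts \<open>a\<close> into (p, x^n), which leaves p^n x^n d'
    as the only term of \<open>u\<close> not visibly in the ideal.\<close>
  have "x * u - x ^ Suc n * (x * b') \<in> ?J"
    using u(2) J(5) by (rule power_ideal_diff)
  then have "x * (p ^ n * a) \<in> ?J"
    by (simp add: ub algebra_simps)
  then obtain c d where cd: "x * (p ^ n * a) = p ^ Suc n * c + x ^ Suc n * d"
    by (auto simp: power_ideal_def)
  have "p ^ n dvd x ^ Suc n * d"
  proof -
    have "x ^ Suc n * d = p ^ n * (x * a - p * c)"
      using cd by (simp add: algebra_simps)
    then show ?thesis by simp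
  qed
  then have "p ^ n dvd d"
    by (rule regular_power [OF reg \<open>p \<noteq> 0\<close>])
  then obtain d' where d': "d = p ^ n * d'" by auto
  have "p ^ n * (x * a) = p ^ n * (p * c + x ^ Suc n * d')"
    using cd by (simp add: d' algebra_simps)
  then have "x * a = p * c + x ^ Suc n * d'"
    using \<open>p \<noteq> 0\<close> by simp
  then have "x * (a - x ^ n * d') = p * c"
    by (simp add: algebra_simps)
  then have "p dvd a - x ^ n * d'"
    using reg by (metis dvd_triv_left)
  then obtain c' where "a - x ^ n * d' = p * c'" ..
  then have "a = p * c' + x ^ n * d'"
    by (simp only: diff_eq_eq)
  then have "u - p ^ n * x ^ n * d' = p ^ Suc n * c' + x ^ Suc n * b'"
    by (simp add: ub algebra_simps)
  then have u_d': "u - p ^ n * x ^ n * d' \<in> ?J"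
    unfolding power_ideal_def by blast
  have px: "p ^ n * x ^ n * s \<in> ?J" if s: "s \<in> power_ideal p x 1" for s
  proof -
    obtain s1 s2 where "s = p * s1 + x * s2"
      using s by (auto simp: power_ideal_def)
    then have "p ^ n * x ^ n * s = p ^ Suc n * (x ^ n * s1) + x ^ Suc n * (p ^ n * s2)"
      by (simp add: algebra_simps)
    then show ?thesis unfolding power_ideal_def by blast
  qed
  have "d' \<notin> power_ideal p x 1"
  proof
    assume "d' \<in> power_ideal p x 1"
    from J(2) [OF u_d' px [OF this]] show False
      using u(1) by simp
  qed
  then have "d' - 1 \<in> power_ideal p x 1"
    using local by blast
  have "x ^ j * p ^ i * r - p ^ n * x ^ n =
      u - p ^ n * x ^ n * d' + p ^ n * x ^ n * (d' - 1)"
    by (simp add: u_def right_diff_distrib mult.assoc)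
  also have "\<dots> \<in> ?J"
    by (rule J(2) [OF u_d' px [OF \<open>d' - 1 \<in> power_ideal p x 1\<close>]])
  finally show ?thesis ..
qed

section \<open>Regularity on the punctured spectrum\<close>

text \<open>The singleton {1} is independent over the base field, so 1 |-> 1 extends from its span
  to a linear functional.\<close>

lemma linear_functional_ex:
  obtains \<phi> :: "'a::field alg_closure \<Rightarrow> 'a" where
    "\<And>y z. \<phi> (y + z) = \<phi> y + \<phi> z" "\<And>c z. \<phi> (to_ac c * z) = c * \<phi> z" "\<phi> 1 = 1"
proof -
  interpret V: vector_space "\<lambda>(c::'a) z. to_ac c * z"
    by unfold_locales (simp_all add: algebra_simps)
  interpret K: vector_space "\<lambda>(c::'a) z. c * z"
    by unfold_locales (simp_all add: algebra_simps)
  interpret VK: vector_space_pair "\<lambda>(c::'a) z. to_ac c * z" "\<lambda>(c::'a) z. c * z" ..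
  have "V.independent {1}"
    by (simp add: V.dependent_single)
  from VK.linear_independent_extend [OF this, of "\<lambda>_. 1"]
  obtain g where g: "Vector_Spaces.linear (\<lambda>(c::'a) z. to_ac c * z) (\<lambda>c z. c * z) g"
    "\<forall>z\<in>{1}. g z = 1"
    by blast
  interpret g: Vector_Spaces.linear "\<lambda>(c::'a) z. to_ac c * z" "\<lambda>(c::'a) z. c * z" g by fact
  show thesis
    by (rule that [of g]) (use g(2) in \<open>simp_all add: g.add g.scale\<close>)
qed

text \<open>All b^i c^j lie in the module spanned by the finitely many with i < m and j < n, and one
  product of denominators clears the values of the functional on these generators.\<close>

lemma integral_common_denominator:
  fixes \<phi> :: "'a::idom fract alg_closure \<Rightarrow> 'a fract"
  assumes \<phi>: "\<And>y z. \<phi> (y + z) = \<phi> y + \<phi> z" "\<And>c z. \<phi> (to_ac c * z) = c * \<phi> z"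
    and bc: "b \<in> absolute_integral_closure" "c \<in> absolute_integral_closure"
  obtains d where "d \<noteq> 0" "\<And>i j. to_fract d * \<phi> (b ^ i * c ^ j) \<in> range to_fract"
proof -
  define N where "N d = {z. \<exists>r. to_fract d * \<phi> z = to_fract r}" for d :: 'a
  have add: "y + z \<in> N d" if yz: "y \<in> N d" "z \<in> N d" for y z d
  proof -
    obtain r s where "to_fract d * \<phi> y = to_fract r" "to_fract d * \<phi> z = to_fract s"
      using yz by (auto simp: N_def)
    then have "to_fract d * \<phi> (y + z) = to_fract (r + s)"
      by (simp add: \<phi> distrib_left)
    then show ?thesis unfolding N_def by blast
  qed
  have smult: "to_closure r * z \<in> N d" if z: "z \<in> N d" for r z d
  proof -
    obtain s where "to_fract d * \<phi> z = to_fract s"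
      using z by (auto simp: N_def)
    then have "to_fract d * \<phi> (to_closure r * z) = to_fract (r * s)"
      by (simp add: to_closure_def \<phi> mult.left_commute)
    then show ?thesis unfolding N_def by blast
  qed
  have sum: "sum g A \<in> N d" if "\<And>i. i \<in> A \<Longrightarrow> g i \<in> N d" for g d and A :: "nat set"
    using that
  proof (induction A rule: infinite_finite_induct)
    case empty
    have "\<phi> 0 = 0" using \<phi>(2) [of 0 0] by simp
    then show ?case by (simp add: N_def exI [of _ 0])
  next
    case (infinite A)
    have "\<phi> 0 = 0" using \<phi>(2) [of 0 0] by simp
    then show ?case using infinite by (simp add: N_def exI [of _ 0])
  qed (simp add: add)
  have N_mult: "z \<in> N (d * e)" "z \<in> N (e * d)" if z: "z \<in> N d" for z d e
  proof -
    obtain s where s: "to_fract d * \<phi> z = to_fract s"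
      using z by (auto simp: N_def)
    have "to_fract (d * e) * \<phi> z = to_fract e * (to_fract d * \<phi> z)"
      by (simp add: mult_ac)
    also have "\<dots> = to_fract (e * s)"
      by (simp add: s)
    finally show "z \<in> N (d * e)" "z \<in> N (e * d)"
      unfolding N_def mult.commute [of e d] by blast+
  qed
  have finite_N: "\<exists>d. d \<noteq> 0 \<and> A \<subseteq> N d" if "finite A" for A
    using that
  proof (induction A)
    case empty
    then show ?case by (intro exI [of _ 1]) simp
  next
    case (insert z A)
    then obtain d where d: "d \<noteq> 0" "A \<subseteq> N d" by blast
    obtain r e where re: "\<phi> z = Fract r e" "e \<noteq> 0"
      by (cases "\<phi> z") auto
    then have "to_fract e * \<phi> z = to_fract r"
      by (simp add: Fract_conv_to_fract)
    then have "z \<in> N e" unfolding N_def by blast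
    with d re N_mult show ?case
      by (intro exI [of _ "d * e"]) auto
  qed
  obtain m a where a: "b ^ m = (\<Sum>i<m. to_closure (a i) * b ^ i)"
    using bc(1) by (auto simp: absolute_integral_closure_iff)
  obtain n a' where a': "c ^ n = (\<Sum>i<n. to_closure (a' i) * c ^ i)"
    using bc(2) by (auto simp: absolute_integral_closure_iff)
  obtain d where d: "d \<noteq> 0" "(\<lambda>(i, j). b ^ i * c ^ j) ` ({..<m} \<times> {..<n}) \<subseteq> N d"
    using finite_N [of "(\<lambda>(i, j). b ^ i * c ^ j) ` ({..<m} \<times> {..<n})"] by auto
  have step1: "b ^ i * c ^ j \<in> N d" if "j < n" for i j
  proof (induction i rule: less_induct)
    case (less i)
    show ?case
    proof (cases "i < m")
      case True
      then show ?thesis using d(2) that by auto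
    next
      case False
      have "b ^ i * c ^ j = b ^ m * (b ^ (i - m) * c ^ j)"
        using False by (simp add: power_add [symmetric] mult.assoc [symmetric])
      also have "\<dots> = (\<Sum>k<m. to_closure (a k) * (b ^ (k + (i - m)) * c ^ j))"
        unfolding a sum_distrib_right power_add by (simp only: mult_ac)
      also have "\<dots> \<in> N d"
        using False by (intro sum smult less) auto
      finally show ?thesis .
    qed
  qed
  have step2: "b ^ i * c ^ j \<in> N d" for i j
  proof (induction j rule: less_induct)
    case (less j)
    show ?case
    proof (cases "j < n")
      case True
      then show ?thesis by (rule step1)
    next
      case False
      have "b ^ i * c ^ j = c ^ n * (b ^ i * c ^ (j - n))"
        using False by (simp add: power_add [symmetric] mult.left_commute)
      also have "\<dots> = (\<Sum>k<n. to_closure (a' k) * (b ^ i * c ^ (k + (j - n))))"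
        unfolding a' sum_distrib_right power_add by (simp only: mult_ac)
      also have "\<dots> \<in> N d"
        using False by (intro sum smult less) auto
      finally show ?thesis .
    qed
  qed
  show thesis
    using that [OF d(1)] step2 by (force simp: N_def)
qed

text \<open>The sections over the punctured spectrum. In the application normality of the absolute integral
  closure would give nothing new, but on this ring \<open>p, x\<close> is a regular sequence without any such proof.\<close>

definition punctured_sections :: "'a::idom \<Rightarrow> 'a \<Rightarrow> 'a fract alg_closure set" where
  "punctured_sections p x =
     {z. \<exists>n. to_closure (p ^ n) * z \<in> absolute_integral_closure \<and>
       to_closure (x ^ n) * z \<in> absolute_integral_closure}"

section \<open>Ring structure and regularity of the punctured sections\<close>

lemma punctured_sections_multiples:
  assumes "z \<in> punctured_sections p x"
  shows "\<exists>n. (\<forall>m\<ge>n. to_closure (p ^ m) * z \<in> absolute_integral_closure) \<and>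
    (\<forall>m\<ge>n. to_closure (x ^ m) * z \<in> absolute_integral_closure)"
proof -
  obtain n where n: "to_closure (p ^ n) * z \<in> absolute_integral_closure"
    "to_closure (x ^ n) * z \<in> absolute_integral_closure"
    using assms by (auto simp: punctured_sections_def)
  have *: "to_closure (q ^ m) * z \<in> absolute_integral_closure"
    if "n \<le> m" "to_closure (q ^ n) * z \<in> absolute_integral_closure" for q m
  proof -
    have "to_closure (q ^ (m - n)) * (to_closure (q ^ n) * z) = to_closure (q ^ (m - n) * q ^ n) * z"
      by (simp add: mult.assoc)
    also have "q ^ (m - n) * q ^ n = q ^ m"
      using that(1) by (simp add: power_add [symmetric])
    finally show ?thesis
      using integral_closure_ring(2) [OF to_closure_integral that(2), of "q ^ (m - n)"] by (simp only:)
  qed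
  show ?thesis
    using * n by blast
qed

lemma punctured_sections_ring:
  assumes "y \<in> punctured_sections p x" "z \<in> punctured_sections p x"
  shows "y + z \<in> punctured_sections p x" "y * z \<in> punctured_sections p x"
proof -
  let ?M = "absolute_integral_closure :: 'a fract alg_closure set"
  obtain m where m: "\<forall>k\<ge>m. to_closure (p ^ k) * y \<in> ?M"
    "\<forall>k\<ge>m. to_closure (x ^ k) * y \<in> ?M"
    using punctured_sections_multiples [OF assms(1)] by blast
  obtain n where n: "\<forall>k\<ge>n. to_closure (p ^ k) * z \<in> ?M"
    "\<forall>k\<ge>n. to_closure (x ^ k) * z \<in> ?M"
    using punctured_sections_multiples [OF assms(2)] by blast
  have "to_closure (q ^ (m + n)) * (y + z) \<in> ?M"
    if "to_closure (q ^ (m + n)) * y \<in> ?M" "to_closure (q ^ (m + n)) * z \<in> ?M" for q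
    using integral_closure_ring(1) [OF that] by (simp add: distrib_left)
  then show "y + z \<in> punctured_sections p x"
    unfolding punctured_sections_def using m n by (intro CollectI exI [of _ "m + n"]) simp
  have "to_closure (q ^ (m + n)) * (y * z) \<in> ?M"
    if "to_closure (q ^ m) * y \<in> ?M" "to_closure (q ^ n) * z \<in> ?M" for q
    using integral_closure_ring(2) [OF that] by (simp add: power_add mult_ac)
  then show "y * z \<in> punctured_sections p x"
    unfolding punctured_sections_def using m n by (intro CollectI exI [of _ "m + n"]) simp
qed

lemma integral_in_punctured_sections:
  "z \<in> absolute_integral_closure \<Longrightarrow> z \<in> punctured_sections p x"
  unfolding punctured_sections_def by (intro CollectI exI [of _ 0]) simp

lemma to_closure_punctured_sections: "to_closure r \<in> punctured_sections p x"
  by (intro integral_in_punctured_sections to_closure_integral)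

lemma power_punctured_sections:
  "z \<in> punctured_sections p x \<Longrightarrow> z ^ n \<in> punctured_sections p x"
  using to_closure_punctured_sections [of 1 p x]
  by (induction n) (simp_all add: punctured_sections_ring)

lemma diff_punctured_sections:
  "y \<in> punctured_sections p x \<Longrightarrow> z \<in> punctured_sections p x \<Longrightarrow> y - z \<in> punctured_sections p x"
  using punctured_sections_ring(1) [of y p x "to_closure (- 1) * z"]
    punctured_sections_ring(2) [OF to_closure_punctured_sections, of z p x "- 1"] by simp

text \<open>For v = y / p also z = x v. Multiples of \<open>v\<close> by high powers of
  \<open>p\<close> are thus controlled by \<open>y\<close>, those by high powers of \<open>x\<close>
  by \<open>z\<close>.\<close>

lemma punctured_sections_regular:
  assumes "p \<noteq> 0" "y \<in> punctured_sections p x" "z \<in> punctured_sections p x"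
    and eq: "to_closure x * y = to_closure p * z"
  shows "\<exists>v\<in>punctured_sections p x. y = to_closure p * v \<and> z = to_closure x * v"
proof -
  let ?M = "absolute_integral_closure :: 'a fract alg_closure set"
  define v where "v = y / to_closure p"
  have v: "y = to_closure p * v" "z = to_closure x * v"
    using eq assms(1) by (simp_all add: v_def field_simps)
  obtain m where m: "\<forall>k\<ge>m. to_closure (p ^ k) * y \<in> ?M"
    using punctured_sections_multiples [OF assms(2)] by blast
  obtain n where n: "\<forall>k\<ge>n. to_closure (x ^ k) * z \<in> ?M"
    using punctured_sections_multiples [OF assms(3)] by blast
  have "to_closure (p ^ (m + n)) * y \<in> ?M" "to_closure (x ^ (m + n)) * z \<in> ?M"
    using m n by simp_all
  then have "to_closure (p ^ Suc (m + n)) * v \<in> ?M" "to_closure (x ^ Suc (m + n)) * v \<in> ?M"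
    by (simp_all add: v mult_ac)
  then have "v \<in> punctured_sections p x"
    unfolding punctured_sections_def by blast
  with v show ?thesis by blast
qed

text \<open>First x^m cancels modulo \<open>p\<close>, one factor at a time; then the factors of p^n
  are split off one by one.\<close>

lemma punctured_sections_regular_power:
  assumes "p \<noteq> 0" "y \<in> punctured_sections p x" "z \<in> punctured_sections p x"
    and eq: "to_closure (x ^ m) * y = to_closure (p ^ n) * z"
  shows "\<exists>v\<in>punctured_sections p x. y = to_closure (p ^ n) * v \<and> z = to_closure (x ^ m) * v"
proof -
  let ?T = "punctured_sections p x"
  note T = punctured_sections_ring to_closure_punctured_sections
  have step: "\<exists>v\<in>?T. y = to_closure p * v"
    if "y \<in> ?T" "z \<in> ?T" "to_closure (x ^ m) * y = to_closure p * z" for m y z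
    using that
  proof (induction m arbitrary: z)
    case 0
    then show ?case by auto
  next
    case (Suc m)
    have "to_closure x * (to_closure (x ^ m) * y) = to_closure p * z"
      using Suc.prems(3) by (simp add: mult.assoc)
    from punctured_sections_regular [OF \<open>p \<noteq> 0\<close> T(2) [OF T(3) Suc.prems(1)] Suc.prems(2) this]
    obtain v where "v \<in> ?T" "to_closure (x ^ m) * y = to_closure p * v" by blast
    with Suc.IH Suc.prems(1) show ?case by blast
  qed
  have "\<exists>v\<in>?T. y = to_closure (p ^ n) * v"
    if "y \<in> ?T" "z \<in> ?T" "to_closure (x ^ m) * y = to_closure (p ^ n) * z" for y z
    using that
  proof (induction n arbitrary: y)
    case 0
    then show ?case by auto
  next
    case (Suc n)
    have "to_closure (x ^ m) * y = to_closure p * (to_closure (p ^ n) * z)"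
      using Suc.prems(3) by (simp add: mult.assoc)
    from step [OF Suc.prems(1) T(2) [OF T(3) Suc.prems(2)] this]
    obtain v where v: "v \<in> ?T" "y = to_closure p * v" ..
    then have "to_closure p * (to_closure (x ^ m) * v) = to_closure p * (to_closure (p ^ n) * z)"
      using Suc.prems(3) by (simp add: mult_ac)
    then have "to_closure (x ^ m) * v = to_closure (p ^ n) * z"
      using \<open>p \<noteq> 0\<close> by simp
    from Suc.IH [OF v(1) Suc.prems(2) this] obtain u where "u \<in> ?T" "v = to_closure (p ^ n) * u" ..
    with v(2) show ?case by (auto simp: mult.assoc)
  qed
  from this [OF assms(2,3) eq] obtain v where v: "v \<in> ?T" "y = to_closure (p ^ n) * v" ..
  with eq have "to_closure (p ^ n) * (to_closure (x ^ m) * v) = to_closure (p ^ n) * z"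
    by (simp add: mult_ac)
  then have "z = to_closure (x ^ m) * v"
    using \<open>p \<noteq> 0\<close> by simp
  with v show ?thesis by blast
qed

text \<open>If \<open>1 = p b + x c\<close>, then \<open>b\<^sup>i c\<^sup>j = p b\<^sup>i\<^sup>+\<^sup>1 c\<^sup>j + x b\<^sup>i c\<^sup>j\<^sup>+\<^sup>1\<close>, so a functional with values in the
  base ring maps \<open>1\<close> into every power of the ideal \<open>(p, x)\<close>.\<close>

lemma one_not_in_punctured_ideal:
  fixes p x :: "'a::idom"
  assumes reg: "\<forall>r. p dvd x * r \<longrightarrow> p dvd r" and "p \<noteq> 0" "x \<noteq> 0"
    and separated: "\<And>r. (\<And>n. r \<in> power_ideal p x n) \<Longrightarrow> r = 0"
    and "b \<in> punctured_sections p x" "c \<in> punctured_sections p x"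
  shows "to_closure p * b + to_closure x * c \<noteq> 1"
proof
  assume one: "to_closure p * b + to_closure x * c = 1"
  let ?M = "absolute_integral_closure :: 'a fract alg_closure set"
  obtain \<phi> :: "'a fract alg_closure \<Rightarrow> 'a fract" where
    \<phi>: "\<And>y z. \<phi> (y + z) = \<phi> y + \<phi> z" "\<And>c z. \<phi> (to_ac c * z) = c * \<phi> z" "\<phi> 1 = 1"
    using linear_functional_ex by blast
  have \<phi>_closure: "\<phi> (to_closure r * z) = to_fract r * \<phi> z" for r z
    by (simp add: to_closure_def \<phi>)
  obtain m where m: "\<forall>k\<ge>m. to_closure (p ^ k) * b \<in> ?M"
    "\<forall>k\<ge>m. to_closure (x ^ k) * b \<in> ?M"
    using punctured_sections_multiples [OF assms(5)] by blast
  obtain n where n: "\<forall>k\<ge>n. to_closure (p ^ k) * c \<in> ?M"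
    "\<forall>k\<ge>n. to_closure (x ^ k) * c \<in> ?M"
    using punctured_sections_multiples [OF assms(6)] by blast
  \<comment> \<open>Multiplication by p^k, or by x^k, makes both \<open>b\<close> and
    \<open>c\<close> integral. Below, \<open>d\<close> clears denominators after scaling by p^k and
    \<open>e\<close> after scaling by x^k.\<close>
  define k where "k = m + n"
  obtain d where d: "d \<noteq> 0"
    "\<And>i j. to_fract d * \<phi> ((to_closure (p ^ k) * b) ^ i * (to_closure (p ^ k) * c) ^ j) \<in> range to_fract"
    using integral_common_denominator [OF \<phi>(1,2) m(1) [rule_format] n(1) [rule_format], of k k]
    unfolding k_def by auto
  obtain e where e: "e \<noteq> 0"
    "\<And>i j. to_fract e * \<phi> ((to_closure (x ^ k) * b) ^ i * (to_closure (x ^ k) * c) ^ j) \<in> range to_fract"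
    using integral_common_denominator [OF \<phi>(1,2) m(2) [rule_format] n(2) [rule_format], of k k]
    unfolding k_def by auto
  \<comment> \<open>Both p^l and x^l multiply this element of the fraction field into the base ring;
    regularity then puts it there already.\<close>
  have "\<exists>r. to_fract (d * e) * \<phi> (b ^ i * c ^ j) = to_fract r" for i j
  proof -
    define q where "q = to_fract (d * e) * \<phi> (b ^ i * c ^ j)"
    define l where "l = k * (i + j)"
    have scale: "\<phi> ((to_closure (s ^ k) * b) ^ i * (to_closure (s ^ k) * c) ^ j) =
        to_fract (s ^ l) * \<phi> (b ^ i * c ^ j)" for s
    proof -
      have "(to_closure (s ^ k) * b) ^ i * (to_closure (s ^ k) * c) ^ j =
          to_closure (s ^ l) * (b ^ i * c ^ j)"
        by (simp add: l_def power_mult_distrib power_mult power_add mult_ac)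
      then show ?thesis by (simp only: \<phi>_closure)
    qed
    obtain r where r: "to_fract d * (to_fract (p ^ l) * \<phi> (b ^ i * c ^ j)) = to_fract r"
      using d(2) [of i j] unfolding scale by auto
    obtain s where s: "to_fract e * (to_fract (x ^ l) * \<phi> (b ^ i * c ^ j)) = to_fract s"
      using e(2) [of i j] unfolding scale by auto
    have pq: "to_fract (p ^ l) * q = to_fract (e * r)"
      unfolding to_fract_mult r [symmetric] by (simp add: q_def mult_ac)
    have xq: "to_fract (x ^ l) * q = to_fract (d * s)"
      unfolding to_fract_mult s [symmetric] by (simp add: q_def mult_ac)
    have "to_fract (x ^ l * (e * r)) = to_fract (p ^ l * (d * s))"
      unfolding to_fract_mult [of "x ^ l"] to_fract_mult [of "p ^ l"] pq [symmetric] xq [symmetric]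
      by (rule mult.left_commute)
    then have "x ^ l * (e * r) = p ^ l * (d * s)"
      by (simp only: to_fract_eq_iff)
    then have "p ^ l dvd x ^ l * (e * r)"
      by (metis dvd_triv_left)
    then have "p ^ l dvd e * r"
      by (rule regular_power [OF reg \<open>p \<noteq> 0\<close>])
    then obtain t where "e * r = p ^ l * t" ..
    with pq have "to_fract (p ^ l) * q = to_fract (p ^ l) * to_fract t"
      by (simp only: to_fract_mult)
    then have "q = to_fract t"
      using \<open>p \<noteq> 0\<close> mult_left_cancel [of "to_fract (p ^ l)"] by simp
    then show ?thesis by (auto simp: q_def)
  qed
  then obtain r where r: "\<And>i j. to_fract (d * e) * \<phi> (b ^ i * c ^ j) = to_fract (r i j)"
    by metis
  have r_step: "r i j = p * r (Suc i) j + x * r i (Suc j)" for i j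
  proof -
    have "b ^ i * c ^ j = b ^ i * c ^ j * (to_closure p * b + to_closure x * c)"
      by (simp add: one)
    also have "\<dots> = to_closure p * (b ^ Suc i * c ^ j) + to_closure x * (b ^ i * c ^ Suc j)"
      by (simp add: algebra_simps)
    finally have "\<phi> (b ^ i * c ^ j) =
        to_fract p * \<phi> (b ^ Suc i * c ^ j) + to_fract x * \<phi> (b ^ i * c ^ Suc j)"
      by (simp only: \<phi>(1) \<phi>_closure)
    then have "to_fract (r i j) = to_fract p * to_fract (r (Suc i) j) + to_fract x * to_fract (r i (Suc j))"
      unfolding r [symmetric] by (simp only: distrib_left mult.left_commute)
    then show ?thesis
      by (simp only: to_fract_mult [symmetric] to_fract_add [symmetric] to_fract_eq_iff)
  qed
  \<comment> \<open>Double induction: \<open>r_step\<close> combines membership of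
    \<open>r (Suc i) j\<close> in (p^s, x^(t+1)) with that of \<open>r i (Suc j)\<close> in
    (p^(s+1), x^t).\<close>
  have "\<exists>u v. r i j = p ^ s * u + x ^ t * v" for i j s t
  proof (induction s arbitrary: i j t)
    case 0
    show ?case by (rule exI [of _ "r i j"], rule exI [of _ 0]) simp
  next
    case (Suc s)
    note IH = this
    show ?case
    proof (induction t arbitrary: i j)
      case 0
      show ?case by (rule exI [of _ 0], rule exI [of _ "r i j"]) simp
    next
      case (Suc t)
      obtain u v where 1: "r (Suc i) j = p ^ s * u + x ^ Suc t * v"
        using IH by blast
      obtain u' v' where 2: "r i (Suc j) = p ^ Suc s * u' + x ^ t * v'"
        using Suc by blast
      have "r i j = p ^ Suc s * (u + x * u') + x ^ Suc t * (p * v + v')"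
        unfolding r_step [of i j] 1 2 by (simp add: algebra_simps)
      then show ?case by blast
    qed
  qed
  then have "r 0 0 \<in> power_ideal p x n" for n
    unfolding power_ideal_def by blast
  \<comment> \<open>This contradicts \<phi> 1 = 1, by which \<open>r 0 0\<close> is the nonzero
    product d e.\<close>
  then have "r 0 0 = 0" by (rule separated)
  then have "to_fract (d * e) = 0"
    using r [of 0 0] \<phi>(3) by simp
  with d(1) e(1) show False by simp
qed

text \<open>Inside \<open>punctured_sections\<close> the relation can be divided by p^k x^k, which
  gives w = x c' + p b'. Modulo \<open>p\<close> the equation w^m = f^n becomes x^m c'^m = x^(2n),
  and cancelling x^(2n) makes 1 a combination of \<open>p\<close> and \<open>x\<close>.\<close>

lemma root_not_in_power_ideal:
  fixes p x f g :: "'a::idom"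
  assumes reg: "\<forall>r. p dvd x * r \<longrightarrow> p dvd r" and "p \<noteq> 0" "x \<noteq> 0"
    and separated: "\<And>r. (\<And>n. r \<in> power_ideal p x n) \<Longrightarrow> r = 0"
    and f: "f = x ^ 2 + p * g" and w: "w \<in> absolute_integral_closure"
    and wm: "w ^ m = to_closure f ^ n" and "2 * n < m"
    and "b \<in> absolute_integral_closure" "c \<in> absolute_integral_closure"
  shows "to_closure (p ^ k * x ^ k) * w \<noteq> to_closure (p ^ Suc k) * b + to_closure (x ^ Suc k) * c"
proof
  let ?T = "punctured_sections p x"
  note T = punctured_sections_ring to_closure_punctured_sections power_punctured_sections
    diff_punctured_sections
  note inT = w [THEN integral_in_punctured_sections, of p x]
    assms(9) [THEN integral_in_punctured_sections, of p x]
    assms(10) [THEN integral_in_punctured_sections, of p x]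
  assume eq: "to_closure (p ^ k * x ^ k) * w = to_closure (p ^ Suc k) * b + to_closure (x ^ Suc k) * c"
  then have "to_closure (x ^ Suc k) * c = to_closure (p ^ k) * (to_closure (x ^ k) * w - to_closure p * b)"
    by (simp add: algebra_simps)
  note c'_eq = this
  have "to_closure (x ^ k) * w - to_closure p * b \<in> ?T"
    by (intro T inT)
  from punctured_sections_regular_power [OF \<open>p \<noteq> 0\<close> inT(3) this c'_eq] obtain c' where
    c': "c' \<in> ?T" "to_closure (x ^ k) * w - to_closure p * b = to_closure (x ^ Suc k) * c'"
    by blast
  then have "to_closure (x ^ k) * (w - to_closure x * c') = to_closure (p ^ 1) * b"
    by (simp add: algebra_simps)
  note b'_eq = this
  have "w - to_closure x * c' \<in> ?T"
    by (intro T inT c'(1))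
  from punctured_sections_regular_power [OF \<open>p \<noteq> 0\<close> this inT(2) b'_eq] obtain b' where
    b': "b' \<in> ?T" "w - to_closure x * c' = to_closure (p ^ 1) * b'"
    by blast
  \<comment> \<open>Raising to a power preserves the class modulo \<open>p\<close>, with a cofactor
    that stays in the ring of sections.\<close>
  have pow: "\<exists>h\<in>?T. (y + to_closure p * z) ^ i = y ^ i + to_closure p * h"
    if yz: "y \<in> ?T" "z \<in> ?T" for y z and i :: nat
  proof (induction i)
    case 0
    show ?case using T(3) [of 0] by (intro bexI [of _ "to_closure 0"]) simp_all
  next
    case (Suc i)
    then obtain h where h: "h \<in> ?T" "(y + to_closure p * z) ^ i = y ^ i + to_closure p * h" ..
    have "(y + to_closure p * z) ^ Suc i =
        y ^ Suc i + to_closure p * (y * h + z * (y ^ i + to_closure p * h))"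
      unfolding power_Suc h(2) by (simp add: algebra_simps)
    moreover have "y * h + z * (y ^ i + to_closure p * h) \<in> ?T"
      by (intro T h(1) yz)
    ultimately show ?case by blast
  qed
  obtain h where h: "h \<in> ?T" "(to_closure x * c' + to_closure p * b') ^ m =
      (to_closure x * c') ^ m + to_closure p * h"
    using pow [OF T(2) [OF T(3) c'(1)] b'(1)] by blast
  obtain h' where h': "h' \<in> ?T" "(to_closure (x ^ 2) + to_closure p * to_closure g) ^ n =
      to_closure (x ^ 2) ^ n + to_closure p * h'"
    using pow [OF T(3) T(3)] by blast
  have w': "w = to_closure x * c' + to_closure p * b'"
    using b'(2) by (simp add: algebra_simps)
  have e1: "(to_closure x * c') ^ m + to_closure p * h = to_closure (x ^ 2) ^ n + to_closure p * h'"
    unfolding h(2) [symmetric] h'(2) [symmetric] w' [symmetric] wm f by simp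
  have e2: "(to_closure x * c') ^ m = to_closure (x ^ (2 * n)) * (to_closure (x ^ (m - 2 * n)) * c' ^ m)"
    using \<open>2 * n < m\<close> by (simp add: power_mult_distrib power_add [symmetric] mult.assoc [symmetric])
  have e3: "to_closure (x ^ 2) ^ n = to_closure (x ^ (2 * n))"
    by (simp add: power_mult)
  have "to_closure (x ^ (2 * n)) * (to_closure (x ^ (m - 2 * n)) * c' ^ m - to_closure 1) =
      (to_closure x * c') ^ m - to_closure (x ^ 2) ^ n"
    unfolding e2 e3 right_diff_distrib by simp
  also have "\<dots> = (to_closure x * c') ^ m + to_closure p * h - to_closure p * h - to_closure (x ^ 2) ^ n"
    by simp
  also have "\<dots> = to_closure (p ^ 1) * (h' - h)"
    unfolding e1 by (simp add: right_diff_distrib)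
  finally have "to_closure (x ^ (2 * n)) * (to_closure (x ^ (m - 2 * n)) * c' ^ m - to_closure 1) =
      to_closure (p ^ 1) * (h' - h)" .
  note v_eq = this
  have "to_closure (x ^ (m - 2 * n)) * c' ^ m - to_closure 1 \<in> ?T" "h' - h \<in> ?T"
    by (intro T c'(1) h(1) h'(1))+
  from punctured_sections_regular_power [OF \<open>p \<noteq> 0\<close> this v_eq] obtain v where
    v: "v \<in> ?T" "to_closure (x ^ (m - 2 * n)) * c' ^ m - to_closure 1 = to_closure (p ^ 1) * v"
    by blast
  \<comment> \<open>As m > 2 n, at least one factor \<open>x\<close> survives the
    cancellation.\<close>
  obtain l where l: "m - 2 * n = Suc l"
    using \<open>2 * n < m\<close> by (metis Suc_diff_Suc)
  have "to_closure p * (to_closure (- 1) * v) + to_closure x * (to_closure (x ^ l) * c' ^ m) = 1"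
    using v(2) unfolding l by (simp add: algebra_simps)
  moreover have "to_closure (- 1) * v \<in> ?T" "to_closure (x ^ l) * c' ^ m \<in> ?T"
    by (intro T v(1) c'(1))+
  ultimately show False
    using one_not_in_punctured_ideal [OF reg \<open>p \<noteq> 0\<close> \<open>x \<noteq> 0\<close> separated] by blast
qed

section \<open>Approximate splittings\<close>

text \<open>A submodule \<open>H\<close> maximal among those that contain \<open>(p\<^sup>n\<^sup>+\<^sup>1, x\<^sup>n\<^sup>+\<^sup>1)\<close> times the absolute integral
  closure but not \<open>(p x)\<^sup>n w\<close> complements the line through \<open>w\<close> modulo this ideal: the quotient of
  the base ring by \<open>(p\<^sup>n\<^sup>+\<^sup>1, x\<^sup>n\<^sup>+\<^sup>1)\<close> is self-injective with socle generated by \<open>(p x)\<^sup>n\<close>.\<close>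

lemma split_modulo_power_ideal:
  fixes p x :: "'a::idom" and n :: nat
  assumes reg: "\<forall>r. p dvd x * r \<longrightarrow> p dvd r" and "p \<noteq> 0" "x \<noteq> 0"
    and local: "\<And>r. r \<in> power_ideal p x 1 \<or> r - 1 \<in> power_ideal p x 1"
    and w: "w \<in> absolute_integral_closure"
    and socle: "\<And>b c. b \<in> absolute_integral_closure \<Longrightarrow> c \<in> absolute_integral_closure \<Longrightarrow>
      to_closure (p ^ n * x ^ n) * w \<noteq> to_closure (p ^ Suc n) * b + to_closure (x ^ Suc n) * c"
  obtains \<rho> where
    "\<And>y z. y \<in> absolute_integral_closure \<Longrightarrow> z \<in> absolute_integral_closure \<Longrightarrow>
      \<rho> (y + z) - (\<rho> y + \<rho> z) \<in> power_ideal p x (Suc n)"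
    "\<And>r z. z \<in> absolute_integral_closure \<Longrightarrow>
      \<rho> (to_closure r * z) - r * \<rho> z \<in> power_ideal p x (Suc n)"
    "\<rho> w - 1 \<in> power_ideal p x (Suc n)"
proof -
  let ?M = "absolute_integral_closure :: 'a fract alg_closure set"
  let ?J = "power_ideal p x (Suc n)"
  note M = integral_closure_ring to_closure_integral
  define u where "u = to_closure (p ^ n * x ^ n) * w"
  define N where "N = {to_closure (p ^ Suc n) * b + to_closure (x ^ Suc n) * c |b c. b \<in> ?M \<and> c \<in> ?M}"
  define submod where "submod = (\<lambda>H. H \<subseteq> ?M \<and> (\<forall>y\<in>H. \<forall>z\<in>H. y + z \<in> H) \<and>
    (\<forall>r. \<forall>z\<in>H. to_closure r * z \<in> H))"
  define \<A> where "\<A> = {H. submod H \<and> N \<subseteq> H \<and> u \<notin> H}"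
  have "N \<in> \<A>"
  proof -
    have "y + z \<in> N" if yz: "y \<in> N" "z \<in> N" for y z
    proof -
      obtain b c b' c' where "y = to_closure (p ^ Suc n) * b + to_closure (x ^ Suc n) * c"
        "z = to_closure (p ^ Suc n) * b' + to_closure (x ^ Suc n) * c'"
        "b \<in> ?M" "c \<in> ?M" "b' \<in> ?M" "c' \<in> ?M"
        using yz by (auto simp: N_def)
      then show ?thesis
        unfolding N_def by (intro CollectI exI [of _ "b + b'"] exI [of _ "c + c'"])
          (simp add: M algebra_simps)
    qed
    moreover have "to_closure r * z \<in> N" if z: "z \<in> N" for r z
    proof -
      obtain b c where "z = to_closure (p ^ Suc n) * b + to_closure (x ^ Suc n) * c"
        "b \<in> ?M" "c \<in> ?M"
        using z by (auto simp: N_def)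
      then show ?thesis
        unfolding N_def
        by (intro CollectI exI [of _ "to_closure r * b"] exI [of _ "to_closure r * c"])
          (simp add: M algebra_simps)
    qed
    moreover have "N \<subseteq> ?M"
      unfolding N_def using M by blast
    moreover have "u \<notin> N"
      unfolding N_def u_def using socle by blast
    ultimately show ?thesis
      by (auto simp: \<A>_def submod_def)
  qed
  moreover have "\<Union>\<C> \<in> \<A>" if "\<C> \<noteq> {}" "subset.chain \<A> \<C>" for \<C>
  proof -
    have sub: "submod H" "N \<subseteq> H" "u \<notin> H" if "H \<in> \<C>" for H
      using \<open>subset.chain \<A> \<C>\<close> that by (auto simp: subset.chain_def \<A>_def)
    have "y + z \<in> \<Union>\<C>" if yz: "y \<in> \<Union>\<C>" "z \<in> \<Union>\<C>" for y z
    proof -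
      obtain H K where HK: "H \<in> \<C>" "y \<in> H" "K \<in> \<C>" "z \<in> K"
        using yz by auto
      then have "H \<subseteq> K \<or> K \<subseteq> H"
        using \<open>subset.chain \<A> \<C>\<close> by (auto simp: subset_chain_def)
      with HK sub [of H] sub [of K] show ?thesis
        unfolding submod_def by blast
    qed
    moreover have "to_closure r * z \<in> \<Union>\<C>" if "z \<in> \<Union>\<C>" for r z
      using that sub(1) unfolding submod_def by blast
    moreover have "\<Union>\<C> \<subseteq> ?M"
      using sub(1) by (intro Union_least) (simp add: submod_def)
    moreover have "N \<subseteq> \<Union>\<C>"
      using sub(2) \<open>\<C> \<noteq> {}\<close> by fast
    moreover have "u \<notin> \<Union>\<C>"
      using sub(3) by fast
    ultimately show ?thesis
      by (simp add: \<A>_def submod_def)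
  qed
  ultimately obtain H where H: "H \<in> \<A>" and max: "\<And>K. K \<in> \<A> \<Longrightarrow> H \<subseteq> K \<Longrightarrow> K = H"
    using subset_Zorn_nonempty [of \<A>] by (metis empty_iff)
  have HM: "H \<subseteq> ?M" and NH: "N \<subseteq> H" and uH: "u \<notin> H"
    and add: "\<And>y z. y \<in> H \<Longrightarrow> z \<in> H \<Longrightarrow> y + z \<in> H"
    and smult: "\<And>r z. z \<in> H \<Longrightarrow> to_closure r * z \<in> H"
    using H by (auto simp: \<A>_def submod_def)
  have diff: "y - z \<in> H" if "y \<in> H" "z \<in> H" for y z
    using add [OF that(1) smult [OF that(2), of "- 1"]] by simp
  have J_H: "to_closure r * z \<in> H" if r: "r \<in> ?J" and z: "z \<in> ?M" for r z
  proof -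
    obtain a b where "r = p ^ Suc n * a + x ^ Suc n * b"
      using r by (auto simp: power_ideal_def)
    then have "to_closure r * z =
        to_closure (p ^ Suc n) * (to_closure a * z) + to_closure (x ^ Suc n) * (to_closure b * z)"
      by (simp add: algebra_simps)
    then have "to_closure r * z \<in> N"
      unfolding N_def using z M by blast
    with NH show ?thesis by blast
  qed
  \<comment> \<open>The map r |-> r w into the quotient by \<open>H\<close> has no kernel beyond the
    ideal: a larger kernel would contain the socle and put \<open>u\<close> into
    \<open>H\<close>.\<close>
  have H_J: "r \<in> ?J" if r: "to_closure r * w \<in> H" for r
  proof (rule ccontr)
    assume "r \<notin> ?J"
    then obtain s where "s * r - p ^ n * x ^ n \<in> ?J"
      using power_ideal_socle [OF reg \<open>p \<noteq> 0\<close> \<open>x \<noteq> 0\<close> local] by blast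
    from diff [OF smult [OF r, of s] J_H [OF this w]] have "u \<in> H"
      by (simp add: u_def algebra_simps)
    with uH show False ..
  qed
  \<comment> \<open>Only the class of \<open>r\<close> modulo (p, x) matters, and the class of 1
    would again put \<open>u\<close> into \<open>H\<close>.\<close>
  have unit: "r \<in> power_ideal p x 1" if r: "to_closure (p ^ n * x ^ n * r) * w \<in> H" for r
  proof (rule ccontr)
    assume "r \<notin> power_ideal p x 1"
    then have "r - 1 \<in> power_ideal p x 1"
      using local by blast
    then obtain a b where "r - 1 = p * a + x * b"
      by (auto simp: power_ideal_def)
    then have "p ^ n * x ^ n * (r - 1) = p ^ Suc n * (x ^ n * a) + x ^ Suc n * (p ^ n * b)"
      by (simp add: algebra_simps)
    then have "p ^ n * x ^ n * (r - 1) \<in> ?J"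
      unfolding power_ideal_def by blast
    from diff [OF r J_H [OF this w]] have "u \<in> H"
      by (simp add: u_def algebra_simps)
    with uH show False ..
  qed
  define G where "G = {h + to_closure r * w |h r. h \<in> H}"
  have GI: "h + to_closure r * w \<in> G" if "h \<in> H" for h r
    using that by (auto simp: G_def)
  have G_shift: "z \<in> G" if "z + to_closure r * w \<in> G" for z r
  proof -
    obtain h s where "z + to_closure r * w = h + to_closure s * w" "h \<in> H"
      using \<open>z + to_closure r * w \<in> G\<close> by (auto simp: G_def)
    then have "z = h + to_closure (s - r) * w"
      by (simp add: algebra_simps)
    then show ?thesis using GI \<open>h \<in> H\<close> by blast
  qed
  have HG: "h \<in> G" if "h \<in> H" for h
    using GI [OF that, of 0] by simp
  \<comment> \<open>Shows that \<open>H\<close> and \<open>w\<close> span everything. An element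
    outside \<open>G\<close> is moved, by multiples of p, x and w, to some z outside
    \<open>G\<close> with p z and x z in \<open>H\<close>; adjoining z to \<open>H\<close> then
    violates maximality.\<close>
  have MG: "z0 \<in> G" if z0: "z0 \<in> ?M" for z0
  proof (rule ccontr)
    assume "z0 \<notin> G"
    moreover have "to_closure p ^ Suc n * z0 \<in> G"
      using J_H [OF power_ideal_closed(4) [where r = 1] z0] HG by simp
    ultimately obtain i where i: "to_closure p ^ i * z0 \<notin> G"
      "to_closure p * (to_closure p ^ i * z0) \<in> G"
      using last_multiple_outside by blast
    have z1: "to_closure p ^ i * z0 \<in> ?M"
      using M(2) [OF M(3) [of "p ^ i"] z0] by simp
    have "to_closure x ^ Suc n * (to_closure p ^ i * z0) \<in> G"
      using J_H [OF power_ideal_closed(5) [where r = 1] z1] HG by simp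
    then obtain j where j: "to_closure x ^ j * (to_closure p ^ i * z0) \<notin> G"
      "to_closure x * (to_closure x ^ j * (to_closure p ^ i * z0)) \<in> G"
      using last_multiple_outside [OF i(1)] by blast
    define z2 where "z2 = to_closure x ^ j * (to_closure p ^ i * z0)"
    have z2: "z2 \<in> ?M" "z2 \<notin> G"
      using M(2) [OF M(3) [of "x ^ j"] z1] j by (simp_all add: z2_def)
    obtain h2 s where h2: "to_closure x * z2 = h2 + to_closure s * w" "h2 \<in> H"
      using j(2) by (auto simp: z2_def G_def)
    obtain h r where h: "to_closure p * (to_closure p ^ i * z0) = h + to_closure r * w" "h \<in> H"
      using i(2) by (auto simp: G_def)
    define h1 where "h1 = to_closure (x ^ j) * h"
    define r1 where "r1 = x ^ j * r"
    have h1: "to_closure p * z2 = h1 + to_closure r1 * w" "h1 \<in> H"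
    proof -
      have "to_closure p * z2 = to_closure x ^ j * (to_closure p * (to_closure p ^ i * z0))"
        by (simp add: z2_def mult_ac)
      then show "to_closure p * z2 = h1 + to_closure r1 * w"
        unfolding h(1) by (simp add: h1_def r1_def algebra_simps)
      show "h1 \<in> H"
        unfolding h1_def by (rule smult [OF h(2)])
    qed
    \<comment> \<open>The two ways to compute x p z2 must agree, which ties the coefficients
      \<open>r1\<close> and \<open>s\<close> together modulo the ideal.\<close>
    have "to_closure (x * r1 - p * s) * w = to_closure p * h2 - to_closure x * h1"
    proof -
      have "to_closure x * (to_closure p * z2) = to_closure p * (to_closure x * z2)"
        by (simp add: mult_ac)
      then show ?thesis
        unfolding h1(1) h2(1) by (simp add: algebra_simps)
    qed
    then have "x * r1 - p * s \<in> ?J"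
      using diff [OF smult [OF h2(2)] smult [OF h1(2)]] by (intro H_J) simp
    then obtain a b where ab: "x * r1 - p * s = p ^ Suc n * a + x ^ Suc n * b"
      by (auto simp: power_ideal_def)
    then have *: "x * (r1 - x ^ n * b) = p * (s + p ^ n * a)"
      by (simp add: algebra_simps)
    then have "p dvd r1 - x ^ n * b"
      using reg by (metis dvd_triv_left)
    then obtain g where g: "r1 - x ^ n * b = p * g" ..
    with * \<open>p \<noteq> 0\<close> have g': "s + p ^ n * a = x * g"
      by (simp add: mult.left_commute)
    have r1: "r1 = x ^ n * b + p * g" and s: "s = x * g - p ^ n * a"
      using g g' by (simp_all add: algebra_simps)
    define z3 where "z3 = z2 - to_closure g * w"
    have z3: "z3 \<in> ?M"
      using M(1) [OF z2(1) M(2) [OF M(3) [of "- g"] w]] by (simp add: z3_def)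
    have pz3: "to_closure p * z3 = h1 + to_closure (x ^ n * b) * w"
      using h1(1) by (simp add: z3_def r1 algebra_simps)
    have xz3: "to_closure x * z3 = h2 - to_closure (p ^ n * a) * w"
      using h2(1) by (simp add: z3_def s algebra_simps)
    \<comment> \<open>Multiplication by p^n turns x^n b into a multiple of the socle generator, so
      \<open>unit\<close> puts \<open>b\<close> into (p, x). Multiplication by x^n does the same for
      \<open>a\<close>.\<close>
    have "to_closure (p ^ n * x ^ n * b) * w = to_closure (p ^ Suc n * 1) * z3 - to_closure (p ^ n) * h1"
    proof -
      have "to_closure (p ^ Suc n * 1) * z3 = to_closure (p ^ n) * (to_closure p * z3)"
        by (simp add: mult_ac)
      then show ?thesis unfolding pz3 by (simp add: algebra_simps)
    qed
    also have "\<dots> \<in> H"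
      by (intro diff smult J_H power_ideal_closed z3 h1)
    finally have "b \<in> power_ideal p x 1" by (rule unit)
    then obtain b1 b2 where b: "b = p * b1 + x * b2"
      by (auto simp: power_ideal_def)
    have "to_closure (p ^ n * x ^ n * a) * w = to_closure (x ^ n) * h2 - to_closure (x ^ Suc n * 1) * z3"
    proof -
      have "to_closure (x ^ Suc n * 1) * z3 = to_closure (x ^ n) * (to_closure x * z3)"
        by (simp add: mult_ac)
      then show ?thesis unfolding xz3 by (simp add: algebra_simps)
    qed
    also have "\<dots> \<in> H"
      by (intro diff smult J_H power_ideal_closed z3 h2)
    finally have "a \<in> power_ideal p x 1" by (rule unit)
    then obtain a1 a2 where a: "a = p * a1 + x * a2"
      by (auto simp: power_ideal_def)
    \<comment> \<open>Here - x^n b1 cancels the term p x^n b1 in p z, and p^n a2 cancels the term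
      p^n x a2 in x z; all other multiples of \<open>w\<close> that arise have coefficients in the
      ideal.\<close>
    define z where "z = z2 + to_closure (p ^ n * a2 - x ^ n * b1 - g) * w"
    have zM: "z \<in> ?M"
      unfolding z_def by (intro M z2 w)
    have zG: "z \<notin> G"
      using G_shift z2(2) unfolding z_def by blast
    have z_z3: "z = z3 + to_closure (p ^ n * a2 - x ^ n * b1) * w"
      by (simp add: z_def z3_def algebra_simps)
    have "to_closure p * z =
        h1 + (to_closure (x ^ Suc n * b2) * w + to_closure (p ^ Suc n * a2) * w)"
      unfolding z_z3 distrib_left pz3 by (simp add: b algebra_simps)
    also have "\<dots> \<in> H"
      by (intro add J_H power_ideal_closed h1 w)
    finally have pz: "to_closure p * z \<in> H" .
    have "to_closure x * z =
        h2 - (to_closure (p ^ Suc n * a1) * w + to_closure (x ^ Suc n * b1) * w)"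
      unfolding z_z3 distrib_left xz3 by (simp add: a algebra_simps)
    also have "\<dots> \<in> H"
      by (intro add diff J_H power_ideal_closed h2 w)
    finally have xz: "to_closure x * z \<in> H" .
    have ideal_z: "to_closure r * z \<in> H" if r: "r \<in> power_ideal p x 1" for r
    proof -
      obtain r1 r2 where "r = p * r1 + x * r2"
        using r by (auto simp: power_ideal_def)
      then have "to_closure r * z = to_closure r1 * (to_closure p * z) + to_closure r2 * (to_closure x * z)"
        by (simp add: algebra_simps)
      then show ?thesis by (simp add: add smult pz xz)
    qed
    define K where "K = {h + to_closure r * z |h r. h \<in> H}"
    have KI: "h + to_closure r * z \<in> K" if "h \<in> H" for h r
      using that by (auto simp: K_def)
    have "submod K"
      unfolding submod_def
    proof (intro conjI ballI allI)
      show "K \<subseteq> ?M"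
        using HM zM by (auto simp: K_def intro!: M)
    next
      fix y y' assume "y \<in> K" "y' \<in> K"
      then obtain h r h' r' where "y = h + to_closure r * z" "y' = h' + to_closure r' * z"
        "h \<in> H" "h' \<in> H"
        by (auto simp: K_def)
      then show "y + y' \<in> K"
        using KI [OF add [of h h'], of "r + r'"] by (simp add: algebra_simps)
    next
      fix s y assume "y \<in> K"
      then obtain h r where "y = h + to_closure r * z" "h \<in> H"
        by (auto simp: K_def)
      then show "to_closure s * y \<in> K"
        using KI [OF smult [of h s], of "s * r"] by (simp add: algebra_simps)
    qed
    moreover have HK: "H \<subseteq> K"
    proof
      fix h assume "h \<in> H"
      then show "h \<in> K" using KI [of h 0] by simp
    qed
    \<comment> \<open>Let u = h + r z. If \<open>r\<close> is in (p, x), then \<open>u\<close> is in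
      \<open>H\<close>; otherwise \<open>r\<close> is 1 modulo (p, x), and solving for
      \<open>z\<close> puts it into \<open>G\<close>.\<close>
    moreover have "u \<notin> K"
    proof
      assume "u \<in> K"
      then obtain h r where u: "u = h + to_closure r * z" "h \<in> H"
        by (auto simp: K_def)
      show False
      proof (cases "r \<in> power_ideal p x 1")
        case True
        then have "u \<in> H"
          unfolding u(1) by (intro add u(2) ideal_z)
        with uH show False ..
      next
        case False
        then have "to_closure (r - 1) * z \<in> H"
          using local by (intro ideal_z) blast
        then have "- 1 * h - to_closure (r - 1) * z \<in> H"
          using smult [OF u(2), of "- 1"] by (intro diff) simp_all
        then have "- 1 * h - to_closure (r - 1) * z + to_closure (p ^ n * x ^ n) * w \<in> G"
          by (rule GI)
        also have "- 1 * h - to_closure (r - 1) * z + to_closure (p ^ n * x ^ n) * w = z"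
          unfolding u_def [symmetric] u(1) by (simp add: algebra_simps)
        finally show False using zG by blast
      qed
    qed
    ultimately have "K = H"
      using NH by (intro max) (auto simp: \<A>_def)
    moreover have "0 \<in> H"
      using smult [OF h1(2), of 0] by simp
    then have "0 + to_closure 1 * z \<in> K"
      by (rule KI)
    ultimately have "z \<in> H" by simp
    with HG zG show False by blast
  qed
  \<comment> \<open>The value \<rho> z is the coefficient of \<open>w\<close> in \<open>z\<close>
    modulo \<open>H\<close>; \<open>H_J\<close> makes it unique, hence linear, modulo the
    ideal.\<close>
  have "\<exists>r. z \<in> ?M \<longrightarrow> z - to_closure r * w \<in> H" for z
  proof (cases "z \<in> ?M")
    case True
    then obtain h r where "z = h + to_closure r * w" "h \<in> H"
      using MG [OF True] unfolding G_def by blast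
    then have "z - to_closure r * w \<in> H" by simp
    then show ?thesis by blast
  qed blast
  then obtain \<rho> where \<rho>: "\<And>z. z \<in> ?M \<Longrightarrow> z - to_closure (\<rho> z) * w \<in> H"
    by metis
  show thesis
  proof (rule that [of \<rho>])
    fix y z :: "'a fract alg_closure" and r
    assume z: "z \<in> ?M"
    have "to_closure (\<rho> (to_closure r * z) - r * \<rho> z) * w =
        to_closure r * (z - to_closure (\<rho> z) * w) -
        (to_closure r * z - to_closure (\<rho> (to_closure r * z)) * w)"
      by (simp add: algebra_simps)
    also have "\<dots> \<in> H"
      by (intro diff smult \<rho> z M)
    finally show "\<rho> (to_closure r * z) - r * \<rho> z \<in> ?J" by (rule H_J)
    assume y: "y \<in> ?M"
    have "to_closure (\<rho> (y + z) - (\<rho> y + \<rho> z)) * w =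
        (y - to_closure (\<rho> y) * w) + (z - to_closure (\<rho> z) * w) -
        (y + z - to_closure (\<rho> (y + z)) * w)"
      by (simp add: algebra_simps)
    also have "\<dots> \<in> H"
      by (intro diff add \<rho> y z M)
    finally show "\<rho> (y + z) - (\<rho> y + \<rho> z) \<in> ?J" by (rule H_J)
  next
    have "to_closure (\<rho> w - 1) * w = to_closure (- 1) * (w - to_closure (\<rho> w) * w)"
      by (simp add: algebra_simps)
    also have "\<dots> \<in> H"
      by (intro smult \<rho> w)
    finally show "\<rho> w - 1 \<in> ?J" by (rule H_J)
  qed
qed

text \<open>A product of finite sets is compact, so the sequence \<open>f\<close> has a cluster
  point \<open>g\<close>. Agreement with \<open>g\<close> at finitely many indices is an open
  condition and thus recurs arbitrarily late. The index set may be uncountable, so \<open>t\<close>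
  is chosen for each finite set separately.\<close>

lemma finite_range_cluster_point:
  fixes f :: "nat \<Rightarrow> 'i \<Rightarrow> int"
  assumes fin: "\<And>i. finite (A i)" and f: "\<And>t i. f t i \<in> A i"
  obtains g where "\<And>I n. finite I \<Longrightarrow> \<exists>t\<ge>n. \<forall>i\<in>I. f t i = g i"
proof -
  have "compactin (product_topology (\<lambda>_. euclidean) UNIV) (PiE UNIV A)"
    unfolding compactin_PiE using fin by (simp add: finite_imp_compact)
  then have "compact (PiE UNIV A)"
    by (simp add: euclidean_product_topology)
  moreover have "filtermap f sequentially \<noteq> bot" "eventually (\<lambda>h. h \<in> PiE UNIV A) (filtermap f sequentially)"
    using f by (simp_all add: filtermap_bot_iff eventually_filtermap PiE_UNIV_domain)
  ultimately obtain g where g: "inf (nhds g) (filtermap f sequentially) \<noteq> bot"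
    unfolding compact_filter by blast
  show thesis
  proof (rule that [of g], rule ccontr)
    fix I :: "'i set" and n :: nat
    assume I: "finite I" and no: "\<not> (\<exists>t\<ge>n. \<forall>i\<in>I. f t i = g i)"
    have "open (\<Inter>i\<in>I. (\<lambda>h. h i) -` {g i})"
      using I by (intro open_INT ballI open_vimage continuous_on_product_coordinates open_discrete) 
    then have "eventually (\<lambda>h. h \<in> (\<Inter>i\<in>I. (\<lambda>h. h i) -` {g i})) (nhds g)"
      by (rule eventually_nhds_in_open) simp
    moreover have "eventually (\<lambda>h. h \<notin> (\<Inter>i\<in>I. (\<lambda>h. h i) -` {g i})) (filtermap f sequentially)"
      unfolding eventually_filtermap
      using no by (intro eventually_sequentiallyI [of n]) auto
    ultimately have "eventually (\<lambda>_. False) (inf (nhds g) (filtermap f sequentially))"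
      unfolding eventually_inf by blast
    with g show False by (simp add: eventually_False)
  qed
qed

section \<open>Power series over the two-adic integers\<close>

lemma two_adic_rep:
  "0 \<le> Rep_two_adic_int z n" "Rep_two_adic_int z n < 2 ^ n"
  "m \<le> n \<Longrightarrow> Rep_two_adic_int z n mod 2 ^ m = Rep_two_adic_int z m"
  using Rep_two_adic_int [of z] by (simp_all add: two_adic_int_compatible)

lemma two_adic_eqI: "(\<And>n. Rep_two_adic_int y n = Rep_two_adic_int z n) \<Longrightarrow> y = z"
  by (simp add: Rep_two_adic_int_inject [symmetric] fun_eq_iff)

lemma two_adic_rep_simps:
  "Rep_two_adic_int 0 n = 0"
  "Rep_two_adic_int 1 n = 1 mod 2 ^ n"
  "Rep_two_adic_int (y + z) n = (Rep_two_adic_int y n + Rep_two_adic_int z n) mod 2 ^ n"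
  "Rep_two_adic_int (y - z) n = (Rep_two_adic_int y n - Rep_two_adic_int z n) mod 2 ^ n"
  "Rep_two_adic_int (y * z) n = (Rep_two_adic_int y n * Rep_two_adic_int z n) mod 2 ^ n"
  by (simp_all add: zero_two_adic_int.rep_eq one_two_adic_int.rep_eq plus_two_adic_int.rep_eq
      minus_two_adic_int.rep_eq times_two_adic_int.rep_eq)

lemma two_adic_rep_sum:
  "Rep_two_adic_int (\<Sum>i\<in>A. f i) n = (\<Sum>i\<in>A. Rep_two_adic_int (f i) n) mod 2 ^ n"
  by (induction A rule: infinite_finite_induct) (simp_all add: two_adic_rep_simps mod_simps)

lemma two_adic_rep_of_nat: "Rep_two_adic_int (of_nat k) n = int k mod 2 ^ n"
  by (induction k) (simp_all add: two_adic_rep_simps mod_simps)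

lemma two_adic_rep_two_power: "Rep_two_adic_int (2 ^ m) n = 2 ^ m mod 2 ^ n"
  using two_adic_rep_of_nat [of "2 ^ m" n] by simp

text \<open>Halving shifts the sequence by one place, because an even entry modulo 2^(n+1)
  determines its half modulo 2^n.\<close>

lemma two_dvd_two_adic_iff: "2 dvd z \<longleftrightarrow> Rep_two_adic_int z 1 = 0"
proof
  assume "2 dvd z"
  then obtain y where "z = 2 * y" ..
  then show "Rep_two_adic_int z 1 = 0"
    using two_adic_rep_two_power [of 1 1] by (simp add: two_adic_rep_simps)
next
  assume z: "Rep_two_adic_int z 1 = 0"
  define y where "y n = Rep_two_adic_int z (Suc n) div 2" for n
  have even: "2 * y n = Rep_two_adic_int z (Suc n)" for n
    using two_adic_rep(3) [of 1 "Suc n" z] z by (simp add: y_def even_iff_mod_2_eq_zero)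
  have range: "0 \<le> y n" "y n < 2 ^ n" for n
    using even [of n] two_adic_rep(1,2) [of z "Suc n"] by simp_all
  moreover have "y (Suc n) mod 2 ^ n = y n" for n
  proof -
    have "2 * (y (Suc n) mod 2 ^ n) = (2 * y (Suc n)) mod 2 ^ Suc n"
      by simp
    also have "\<dots> = 2 * y n"
      unfolding even by (rule two_adic_rep(3)) simp
    finally show ?thesis by simp
  qed
  ultimately have y: "Rep_two_adic_int (Abs_two_adic_int y) = y"
    by (intro Abs_two_adic_int_inverse) simp
  have "z = 2 * Abs_two_adic_int y"
  proof (rule two_adic_eqI)
    fix n
    have "Rep_two_adic_int (2 * Abs_two_adic_int y) n = (2 * y n) mod 2 ^ n"
      using two_adic_rep_two_power [of 1 n] by (simp add: two_adic_rep_simps y mod_simps)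
    also have "\<dots> = Rep_two_adic_int z n"
      unfolding even by (rule two_adic_rep(3)) simp
    finally show "Rep_two_adic_int z n = Rep_two_adic_int (2 * Abs_two_adic_int y) n" by simp
  qed
  then show "2 dvd z" by simp
qed

lemma two_adic_two_nonzero: "(2 :: two_adic_int) \<noteq> 0"
proof
  assume "(2 :: two_adic_int) = 0"
  \<comment> \<open>Entries are compared modulo 4, since modulo 2 both vanish.\<close>
  then have "Rep_two_adic_int 2 2 = Rep_two_adic_int 0 2" by simp
  then show False
    using two_adic_rep_two_power [of 1 2] by (simp add: two_adic_rep_simps)
qed

section \<open>Divisibility by 2 and the ideals (2^n, X^n) in the power series ring\<close>

lemma fps_two_power_nth: "fps_nth (2 ^ n * r) i = 2 ^ n * fps_nth r i"
  for r :: "'a::comm_ring_1 fps"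
proof -
  have "(2 ^ n :: 'a fps) = fps_const (2 ^ n)"
    by (simp add: numeral_fps_const)
  then show ?thesis by (simp only: fps_mult_left_const_nth)
qed

lemma fps_two_dvd_regular:
  "\<forall>r :: two_adic_int fps. 2 dvd fps_X * r \<longrightarrow> 2 dvd r"
proof (intro allI impI)
  fix r :: "two_adic_int fps"
  assume "2 dvd fps_X * r"
  then obtain s where s: "fps_X * r = 2 * s" ..
  have "r = 2 * fps_shift 1 s"
  proof (rule fps_ext)
    fix i
    have "fps_nth r i = fps_nth (fps_X * r) (Suc i)" by simp
    also have "\<dots> = fps_nth (2 ^ 1 * s) (Suc i)"
      by (simp add: s)
    also have "\<dots> = fps_nth (2 ^ 1 * fps_shift 1 s) i"
      unfolding fps_two_power_nth by simp
    finally show "fps_nth r i = fps_nth (2 * fps_shift 1 s) i" by simp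
  qed
  then show "2 dvd r" by simp
qed

lemma fps_two_adic_decompose:
  fixes r :: "two_adic_int fps"
  assumes "2 dvd fps_nth r 0"
  shows "r \<in> power_ideal 2 fps_X 1"
proof -
  obtain c where c: "fps_nth r 0 = 2 * c" using assms ..
  have "r = fps_const (fps_nth r 0) + fps_X * fps_shift 1 r"
    by (rule fps_ext) (simp split: nat.split add: fps_X_mult_nth)
  also have "fps_const (fps_nth r 0) = 2 ^ 1 * fps_const c"
    by (simp add: c numeral_fps_const)
  finally have "r = 2 ^ 1 * fps_const c + fps_X ^ 1 * fps_shift 1 r" by simp
  then show ?thesis unfolding power_ideal_def by blast
qed

text \<open>The residue field has two elements: the constant coefficient is 0 or 1 modulo 2.\<close>

lemma fps_two_adic_local:
  "r \<in> power_ideal 2 fps_X 1 \<or> r - 1 \<in> power_ideal 2 fps_X 1" for r :: "two_adic_int fps"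
proof -
  have "Rep_two_adic_int (fps_nth r 0) 1 = 0 \<or> Rep_two_adic_int (fps_nth r 0) 1 = 1"
    using two_adic_rep(1,2) [of "fps_nth r 0" 1] by auto
  then have "2 dvd fps_nth r 0 \<or> 2 dvd fps_nth (r - 1) 0"
    by (auto simp: two_dvd_two_adic_iff two_adic_rep_simps)
  then show ?thesis using fps_two_adic_decompose by blast
qed

lemma fps_two_adic_power_idealD:
  fixes r :: "two_adic_int fps"
  assumes "r \<in> power_ideal 2 fps_X n" "i < n" "m \<le> n"
  shows "Rep_two_adic_int (fps_nth r i) m = 0"
proof -
  obtain a b where "r = 2 ^ n * a + fps_X ^ n * b"
    using assms(1) by (auto simp: power_ideal_def)
  then have "fps_nth r i = 2 ^ n * fps_nth a i"
    using assms(2) by (simp add: fps_two_power_nth fps_X_power_mult_nth)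
  moreover have "(2 ^ n mod 2 ^ m :: int) = 0"
    using assms(3) by (simp add: le_imp_power_dvd)
  ultimately show ?thesis
    by (simp add: two_adic_rep_simps two_adic_rep_two_power)
qed

lemma fps_two_adic_separated:
  fixes r :: "two_adic_int fps"
  assumes "\<And>n. r \<in> power_ideal 2 fps_X n"
  shows "r = 0"
proof (rule fps_ext, rule two_adic_eqI)
  fix i n
  show "Rep_two_adic_int (fps_nth r i) n = Rep_two_adic_int (fps_nth 0 i) n"
    \<comment> \<open>The exponent i + n + 1 exceeds the coefficient index \<open>i\<close> and is
      at least the precision \<open>n\<close>.\<close>
    using fps_two_adic_power_idealD [OF assms, of i "Suc (i + n)" n] by (simp add: two_adic_rep_simps)
qed

text \<open>The residue map onto the field with two elements, modelled by \<open>bit\<close>: the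
  constant coefficient modulo 2.\<close>

lemma comm_ring_hom_residue:
  "comm_ring_hom (\<lambda>r. of_int (Rep_two_adic_int (fps_nth r 0) 1) :: bit)"
proof -
  have "of_int (k mod 2) = (of_int k :: bit)" for k
  proof -
    have "(of_int k :: bit) = of_int (2 * (k div 2) + k mod 2)" by simp
    also have "\<dots> = of_int (k mod 2)" by (simp only: of_int_add of_int_mult) simp
    finally show ?thesis by simp
  qed
  then show ?thesis
    by unfold_locales (simp_all add: two_adic_rep_simps)
qed

lemma fps_two_adic_rep_cong:
  fixes r s :: "two_adic_int fps"
  assumes "r - s \<in> power_ideal 2 fps_X k" "i < k" "n \<le> k"
  shows "Rep_two_adic_int (fps_nth r i) n = Rep_two_adic_int (fps_nth s i) n"
proof -
  let ?a = "Rep_two_adic_int (fps_nth r i) n" and ?b = "Rep_two_adic_int (fps_nth s i) n"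
  have "(?a - ?b) mod 2 ^ n = 0"
    using fps_two_adic_power_idealD [OF assms] by (simp add: two_adic_rep_simps)
  then have "?a mod 2 ^ n = ?b mod 2 ^ n"
    by (simp add: mod_eq_dvd_iff dvd_eq_mod_eq_0)
  then show ?thesis by (simp add: two_adic_rep)
qed

text \<open>Splittings modulo the powers of the maximal ideal accumulate at an exact splitting, because
  the set of all maps into the compact ring of two-adic power series is compact.\<close>

lemma two_adic_linear_splitting:
  fixes w :: "two_adic_int fps fract alg_closure"
  assumes w: "w \<in> absolute_integral_closure"
    and socle: "\<And>n b c. b \<in> absolute_integral_closure \<Longrightarrow> c \<in> absolute_integral_closure \<Longrightarrow>
      to_closure (2 ^ n * fps_X ^ n) * w \<noteq> to_closure (2 ^ Suc n) * b + to_closure (fps_X ^ Suc n) * c"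
  obtains \<phi> where
    "\<And>y z. y \<in> absolute_integral_closure \<Longrightarrow> z \<in> absolute_integral_closure \<Longrightarrow> \<phi> (y + z) = \<phi> y + \<phi> z"
    "\<And>r z. z \<in> absolute_integral_closure \<Longrightarrow> \<phi> (to_closure r * z) = r * \<phi> z"
    "\<phi> w = 1"
proof -
  let ?M = "absolute_integral_closure :: two_adic_int fps fract alg_closure set"
  let ?J = "\<lambda>n. power_ideal 2 fps_X (Suc n) :: two_adic_int fps set"
  have "\<exists>\<rho>. (\<forall>y\<in>?M. \<forall>z\<in>?M. \<rho> (y + z) - (\<rho> y + \<rho> z) \<in> ?J n) \<and>
      (\<forall>r. \<forall>z\<in>?M. \<rho> (to_closure r * z) - r * \<rho> z \<in> ?J n) \<and> \<rho> w - 1 \<in> ?J n" for n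
  proof (rule split_modulo_power_ideal [OF fps_two_dvd_regular _ _ fps_two_adic_local w socle])
    show "(2 :: two_adic_int fps) \<noteq> 0"
      using two_adic_two_nonzero by (simp add: numeral_fps_const)
  qed (simp_all, blast)
  then obtain \<rho> where
    \<rho>_add: "\<And>n y z. y \<in> ?M \<Longrightarrow> z \<in> ?M \<Longrightarrow> \<rho> n (y + z) - (\<rho> n y + \<rho> n z) \<in> ?J n" and
    \<rho>_smult: "\<And>n r z. z \<in> ?M \<Longrightarrow> \<rho> n (to_closure r * z) - r * \<rho> n z \<in> ?J n" and
    \<rho>_w: "\<And>n. \<rho> n w - 1 \<in> ?J n"
    by metis
  \<comment> \<open>An approximate splitting is recorded by integers indexed by an element, a
    coefficient index and a two-adic precision; each index allows only finitely many values.\<close>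
  define f where "f = (\<lambda>t (z, i, n). Rep_two_adic_int (fps_nth (\<rho> t z) i) n)"
  have "f t i \<in> (case i of (z, i, n) \<Rightarrow> {0..<2 ^ n})" for t i
    by (cases i) (simp add: f_def two_adic_rep)
  moreover have "finite (case i of (z :: two_adic_int fps fract alg_closure, i :: nat, n) \<Rightarrow> {0..<2 ^ n :: int})" for i
    by (cases i) simp
  ultimately obtain g where g: "\<And>I n. finite I \<Longrightarrow> \<exists>t\<ge>n. \<forall>i\<in>I. f t i = g i"
    using finite_range_cluster_point [of "\<lambda>(z, i, n). {0..<2 ^ n}" f] by metis
  define \<phi> where "\<phi> z = Abs_fps (\<lambda>i. Abs_two_adic_int (\<lambda>n. g (z, i, n)))" for z
  have \<phi>: "Rep_two_adic_int (fps_nth (\<phi> z) i) n = g (z, i, n)" for z i n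
  proof -
    \<comment> \<open>Compatibility involves only two indices, at which \<open>g\<close> agrees with
      an actual approximation.\<close>
    have "0 \<le> g (z, i, n) \<and> g (z, i, n) < 2 ^ n \<and> g (z, i, Suc n) mod 2 ^ n = g (z, i, n)" for n
    proof -
      obtain t where "f t (z, i, n) = g (z, i, n)" "f t (z, i, Suc n) = g (z, i, Suc n)"
        using g [of "{(z, i, n), (z, i, Suc n)}" 0] by auto
      then show ?thesis
        using two_adic_rep(1,2) [of "fps_nth (\<rho> t z) i" n]
          two_adic_rep(3) [of n "Suc n" "fps_nth (\<rho> t z) i"] by (simp add: f_def)
    qed
    then have "Rep_two_adic_int (Abs_two_adic_int (\<lambda>n. g (z, i, n))) = (\<lambda>n. g (z, i, n))"
      by (intro Abs_two_adic_int_inverse) simp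
    then show ?thesis by (simp add: \<phi>_def)
  qed
  \<comment> \<open>With t at least i + n, the congruences satisfied by \<open>\<rho> t\<close> are
    fine enough to decide coefficient \<open>i\<close> modulo 2^n.\<close>
  have approx: "\<exists>t\<ge>i + n. \<forall>(z, j)\<in>I.
      Rep_two_adic_int (fps_nth (\<rho> t z) j) n = Rep_two_adic_int (fps_nth (\<phi> z) j) n"
    if "finite I" for I i n
    using g [of "(\<lambda>(z, j). (z, j, n)) ` I" "i + n"] that by (auto simp: f_def \<phi>)
  show thesis
  proof (rule that [of \<phi>])
    fix y z assume yz: "y \<in> ?M" "z \<in> ?M"
    show "\<phi> (y + z) = \<phi> y + \<phi> z"
    proof (rule fps_ext, rule two_adic_eqI)
      fix i n
      obtain t where t: "t \<ge> i + n"
        "Rep_two_adic_int (fps_nth (\<phi> y) i) n = Rep_two_adic_int (fps_nth (\<rho> t y) i) n"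
        "Rep_two_adic_int (fps_nth (\<phi> z) i) n = Rep_two_adic_int (fps_nth (\<rho> t z) i) n"
        "Rep_two_adic_int (fps_nth (\<phi> (y + z)) i) n = Rep_two_adic_int (fps_nth (\<rho> t (y + z)) i) n"
        using approx [of "{(y, i), (z, i), (y + z, i)}" i n] by auto
      then have "Rep_two_adic_int (fps_nth (\<rho> t (y + z)) i) n = Rep_two_adic_int (fps_nth (\<rho> t y + \<rho> t z) i) n"
        by (intro fps_two_adic_rep_cong [OF \<rho>_add [OF yz]]) simp_all
      with t(2-4) show "Rep_two_adic_int (fps_nth (\<phi> (y + z)) i) n = Rep_two_adic_int (fps_nth (\<phi> y + \<phi> z) i) n"
        by (simp add: two_adic_rep_simps)
    qed
  next
    fix r z assume z: "z \<in> ?M"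
    show "\<phi> (to_closure r * z) = r * \<phi> z"
    proof (rule fps_ext, rule two_adic_eqI)
      fix i n
      \<comment> \<open>Coefficient \<open>i\<close> of a product involves all coefficients up to
        \<open>i\<close>, so agreement is requested at all of them.\<close>
      obtain t where t: "t \<ge> i + n" "\<forall>(z, j)\<in>insert (to_closure r * z, i) ({z} \<times> {..i}).
          Rep_two_adic_int (fps_nth (\<rho> t z) j) n = Rep_two_adic_int (fps_nth (\<phi> z) j) n"
        using approx [of "insert (to_closure r * z, i) ({z} \<times> {..i})" i n] by auto
      have "Rep_two_adic_int (fps_nth (\<phi> (to_closure r * z)) i) n = Rep_two_adic_int (fps_nth (\<rho> t (to_closure r * z)) i) n"
        using t(2) by simp
      also have "\<dots> = Rep_two_adic_int (fps_nth (r * \<rho> t z) i) n"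
        using t(1) by (intro fps_two_adic_rep_cong [OF \<rho>_smult [OF z]]) simp_all
      also have "\<dots> = Rep_two_adic_int (fps_nth (r * \<phi> z) i) n"
        unfolding fps_mult_nth two_adic_rep_sum two_adic_rep_simps
        using t(2) by (intro arg_cong [of _ _ "\<lambda>k. k mod 2 ^ n"] sum.cong) auto
      finally show "Rep_two_adic_int (fps_nth (\<phi> (to_closure r * z)) i) n = Rep_two_adic_int (fps_nth (r * \<phi> z) i) n" .
    qed
  next
    show "\<phi> w = 1"
    proof (rule fps_ext, rule two_adic_eqI)
      fix i n
      obtain t where t: "t \<ge> i + n"
          "Rep_two_adic_int (fps_nth (\<rho> t w) i) n = Rep_two_adic_int (fps_nth (\<phi> w) i) n"
        using approx [of "{(w, i)}" i n] by auto
      then show "Rep_two_adic_int (fps_nth (\<phi> w) i) n = Rep_two_adic_int (fps_nth 1 i) n"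
        using fps_two_adic_rep_cong [OF \<rho>_w [of t], of i n] by simp
    qed
  qed
qed

section \<open>Purity of roots\<close>

text \<open>By \<open>root_not_in_power_ideal\<close> the socle condition holds for every
  \<open>k\<close>, so an exact retraction exists.\<close>

lemma pure_root:
  fixes f g :: "two_adic_int fps"
  assumes f: "f = fps_X ^ 2 + 2 * g" and w: "w \<in> absolute_integral_closure"
    and wm: "w ^ m = to_closure f ^ n" "2 * n < m"
  shows "pure_map ring_of_type_algebra self_module plus_module (\<lambda>s. to_closure s * w)"
proof -
  have two: "(2 :: two_adic_int fps) \<noteq> 0"
    using two_adic_two_nonzero by (simp add: numeral_fps_const)
  have "to_closure (2 ^ k * fps_X ^ k) * w \<noteq> to_closure (2 ^ Suc k) * b + to_closure (fps_X ^ Suc k) * c"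
    if "b \<in> absolute_integral_closure" "c \<in> absolute_integral_closure" for k b c
    by (rule root_not_in_power_ideal [OF fps_two_dvd_regular two _ fps_two_adic_separated f w wm that])
      simp_all
  then obtain \<phi> where \<phi>:
    "\<And>y z. y \<in> absolute_integral_closure \<Longrightarrow> z \<in> absolute_integral_closure \<Longrightarrow> \<phi> (y + z) = \<phi> y + \<phi> z"
    "\<And>r z. z \<in> absolute_integral_closure \<Longrightarrow> \<phi> (to_closure r * z) = r * \<phi> z"
    "\<phi> w = 1"
    using two_adic_linear_splitting [OF w] by metis
  show ?thesis
  proof (rule pure_map_if_split [OF module_self_module module_plus_module module_map_plus_module [OF w]])
    show "module_map ring_of_type_algebra plus_module self_module \<phi>"
      by (simp add: module_map_def plus_module_def self_module_def \<phi>)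
    show "\<phi> (to_closure s * w) = s" for s
      by (simp add: \<phi> w)
  qed
qed

lemma not_pure_root:
  fixes f :: "two_adic_int fps"
  assumes "a \<ge> 2" and f: "f = 2 ^ a + fps_X ^ 2" and w: "w \<in> absolute_integral_closure"
    and wm: "w ^ m = to_closure f ^ n" "m > 0" "m \<le> 2 * n"
  shows "\<not> pure_map ring_of_type_algebra self_module plus_module (\<lambda>s. to_closure s * w)"
proof -
  have two: "to_closure 2 = (2 :: two_adic_int fps fract alg_closure)"
    using to_closure_simps(3) [of 1 "1 :: two_adic_int fps"] by simp
  have two_nz: "(2 :: two_adic_int fps fract alg_closure) \<noteq> 0"
    using two_adic_two_nonzero unfolding two [symmetric] by (simp add: numeral_fps_const)
  have "fps_nth f 2 = 1"
    using fps_two_power_nth [of a "1 :: two_adic_int fps" 2] by (simp add: f)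
  then have "f \<noteq> 0" by auto
  obtain y where y: "y ^ 2 = to_closure f"
    using nth_root_exists [of 2 "to_closure f"] by auto
  with \<open>f \<noteq> 0\<close> have "y \<noteq> 0" by auto
  define v where "v = (y - to_closure fps_X) / 2"
  have y_v: "y = to_closure fps_X + 2 * v"
    using two_nz by (simp add: v_def)
  \<comment> \<open>Since (x + 2 v)^2 - x^2 = 4 (v^2 + x v) equals 2^a with a \<ge> 2, division by 4
    gives a monic equation for \<open>v\<close> over the base ring.\<close>
  have "2 * 2 * (v ^ 2 + to_closure fps_X * v) = y ^ 2 - to_closure fps_X ^ 2"
    by (simp add: y_v power2_eq_square algebra_simps)
  also have "\<dots> = 2 ^ a"
    by (simp add: y f two)
  also have "2 ^ a = 2 * 2 * (2 ^ (a - 2) :: two_adic_int fps fract alg_closure)"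
    using assms(1) by (metis le_add_diff_inverse mult.assoc power2_eq_square power_add)
  finally have "2 * 2 * (v ^ 2 + to_closure fps_X * v) = 2 * 2 * 2 ^ (a - 2)" .
  moreover have "2 * 2 \<noteq> (0 :: two_adic_int fps fract alg_closure)"
    using two_nz by (simp only: mult_eq_0_iff) simp
  ultimately have "v ^ 2 + to_closure fps_X * v = 2 ^ (a - 2)"
    by (metis mult_left_cancel)
  then have "v ^ 2 = (\<Sum>i<2. to_closure (if i = 0 then 2 ^ (a - 2) else - fps_X) * v ^ i)"
    by (simp add: numeral_2_eq_2 two [unfolded numeral_2_eq_2] eq_diff_eq)
  then have v: "v \<in> absolute_integral_closure"
    unfolding absolute_integral_closure_iff
    by (intro exI [of _ 2] exI [of _ "\<lambda>i. if i = 0 then 2 ^ (a - 2) else - fps_X"])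
  \<comment> \<open>Integral because b^(2 m) = f^(2 n - m), where the exponent is nonnegative as n /
    m is at least 1/2.\<close>
  define b where "b = w / y"
  have "b ^ (2 * m) = (w ^ m) ^ 2 / (y ^ 2) ^ m"
    by (simp add: b_def power_divide power_mult [symmetric] mult.commute)
  also have "\<dots> = to_closure f ^ (2 * n) / to_closure f ^ m"
    by (simp add: wm(1) y power_mult [symmetric] mult.commute)
  also have "\<dots> = to_closure f ^ (2 * n - m)"
    using \<open>f \<noteq> 0\<close> wm(3) by (simp add: power_diff)
  also have "\<dots> = to_closure (f ^ (2 * n - m))" by simp
  finally have "b ^ (2 * m) \<in> range to_closure"
    by (rule range_eqI)
  then have b: "b \<in> absolute_integral_closure"
    using wm(2) by (intro root_integral [of "2 * m"]) simp_all
  have "w = b * y"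
    using \<open>y \<noteq> 0\<close> by (simp add: b_def)
  then have w_eq: "w = to_closure 2 * (b * v) + to_closure fps_X * b"
    by (simp add: y_v two algebra_simps)
  show ?thesis
    by (rule not_pure_if_in_ideal [OF comm_ring_hom_residue _ _ integral_closure_ring(2) [OF b v] b w_eq])
      (use two_dvd_two_adic_iff [of 2] in \<open>simp_all add: numeral_fps_const two_adic_rep_simps\<close>)
qed

theorem proposition4p6:
  fixes a :: nat
  assumes "a \<ge> 2"
  shows "ppt (2 ^ a + fps_X ^ 2 :: two_adic_int fps) = 1 / 2"
proof -
  define f :: "two_adic_int fps" where "f = 2 ^ a + fps_X ^ 2"
  let ?pure = "\<lambda>\<alpha>. pure_map ring_of_type_algebra self_module plus_module
    (\<lambda>s. to_closure s * rat_power (to_closure f) \<alpha>)"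
  \<comment> \<open>Purity fails at 1/2 itself, so the supremum is not attained.\<close>
  have pure_iff: "?pure \<alpha> \<longleftrightarrow> \<alpha> < 1 / 2" if \<alpha>: "0 \<le> \<alpha>" for \<alpha>
  proof -
    define w where "w = rat_power (to_closure f) \<alpha>"
    obtain n m :: nat where nm: "m > 0" "\<alpha> = of_nat n / of_nat m" "w ^ m = to_closure f ^ n"
      using rat_power_to_closure(2) [OF \<alpha>, of f] by (auto simp: w_def)
    have w: "w \<in> absolute_integral_closure"
      unfolding w_def by (rule rat_power_to_closure(1) [OF \<alpha>])
    have "\<alpha> < 1 / 2 \<longleftrightarrow> of_nat (2 * n) < (of_nat m :: rat)"
      using nm(1) by (simp add: nm(2) field_simps)
    then have less: "\<alpha> < 1 / 2 \<longleftrightarrow> 2 * n < m"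
      by (simp only: of_nat_less_iff)
    \<comment> \<open>As \<open>a\<close> is positive, \<open>f\<close> is X^2 modulo 2, with
      cofactor 2^(a-1).\<close>
    have "f = fps_X ^ 2 + 2 * 2 ^ (a - 1)"
      using assms by (simp add: f_def power_Suc [symmetric] del: power_Suc)
    then show ?thesis
      using pure_root [OF _ w nm(3)] not_pure_root [OF assms f_def w nm(3,1)] less
      unfolding w_def [symmetric] by (metis not_less)
  qed
  have half: "(1 / 2 :: ereal) = ereal (1 / 2)"
    by (simp add: one_ereal_def numeral_eq_ereal)
  have "ppt f = (SUP \<alpha> \<in> {\<alpha> :: rat. 0 \<le> \<alpha> \<and> \<alpha> < 1 / 2}. ereal (real_of_rat \<alpha>))"
    unfolding ppt_def using pure_iff by (intro SUP_cong) auto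
  also have "\<dots> = ereal (1 / 2)"
  proof (rule antisym)
    show "(SUP \<alpha> \<in> {\<alpha> :: rat. 0 \<le> \<alpha> \<and> \<alpha> < 1 / 2}. ereal (real_of_rat \<alpha>)) \<le> ereal (1 / 2)"
    proof (rule SUP_least)
      fix \<alpha> :: rat assume "\<alpha> \<in> {\<alpha>. 0 \<le> \<alpha> \<and> \<alpha> < 1 / 2}"
      then have "real_of_rat \<alpha> \<le> real_of_rat (1 / 2)"
        by (simp only: of_rat_less_eq) auto
      then show "ereal (real_of_rat \<alpha>) \<le> ereal (1 / 2)"
        by (simp add: of_rat_divide)
    qed
    show "ereal (1 / 2) \<le> (SUP \<alpha> \<in> {\<alpha> :: rat. 0 \<le> \<alpha> \<and> \<alpha> < 1 / 2}. ereal (real_of_rat \<alpha>))"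
      unfolding le_SUP_iff
    proof (intro allI impI)
      fix u assume "u < ereal (1 / 2)"
      \<comment> \<open>Replacing \<open>u\<close> by \<open>max u 0\<close> excludes minus infinity
        and makes the rational found above it positive.\<close>
      then have "max u 0 < ereal (1 / 2)" by simp
      then obtain r where r: "max u 0 = ereal r" "r < 1 / 2"
        by (cases "max u 0") auto
      then have "0 \<le> r" by (metis ereal_less_eq(5) max.cobounded2)
      obtain q where q: "r < real_of_rat q" "real_of_rat q < 1 / 2"
        using of_rat_dense [OF r(2)] by blast
      have "0 < real_of_rat q"
        using q(1) \<open>0 \<le> r\<close> by (rule order_le_less_trans [rotated])
      moreover have "real_of_rat q < real_of_rat (1 / 2)"
        using q(2) by (simp add: of_rat_divide)
      ultimately have "0 \<le> q" "q < 1 / 2"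
        by (simp_all only: of_rat_less zero_less_of_rat_iff less_imp_le)
      moreover have "u < ereal (real_of_rat q)"
        using q(1) r(1) by (metis ereal_less(2) less_ereal.simps(1) max.cobounded1 order_le_less_trans)
      ultimately show "\<exists>\<alpha>\<in>{\<alpha> :: rat. 0 \<le> \<alpha> \<and> \<alpha> < 1 / 2}. u < ereal (real_of_rat \<alpha>)"
        by blast
    qed
  qed
  finally show ?thesis
    by (simp only: f_def half)
qed

end
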